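(* Let $M$ be a pseudo-Riemannian hyperquadric $S^n_v$ or $H^n_v$ in its ambient pseudo-Euclidean space $\mathbb{V}$, and let $\sigma$ be a conformal gradient field on $M$ whose pole vector $a\in\mathbb{V}$ has pseudo-length $\mu=\langle a,a\rangle\in\mathbb{R}$. Let $p,q\in\mathbb{R}$. (1) If $\mu\geq0$ then $\sigma$ is $(p,q)$-harmonic if and only if $$n>2,\quad \mu=\frac1{n-2},\quad p=n+1,\quad q=2-n.$$ (2) If $\mu<0$ then $\sigma$ is $(p,q)$-harmonic if and only if $\mu=-1$ and either $$p=n+1,\quad q=\frac{1+n-n^2}{n},$$ or $$n>2,\quad p=\frac1{2-n},\quad q=0.$$
   Context: $\mathbb{R}^{n+1}_u$ denotes $\mathbb{R}^{n+1}$ with inner product $\langle x,y\rangle=x_1y_1+\cdots+x_{n+1-u}y_{n+1-u}-\cdots-x_{n+1}y_{n+1}$ of index $u$. For $n\geq2$ and $0\leq v\leq n$, the unit pseudo-sphere is $S^n_v=\{x\in\mathbb{R}^{n+1}_v:\langle x,x\rangle=1\}$ and unit pseudo-hyperbolic space is $H^n_v=\{x\in\mathbb{R}^{n+1}_{v+1}:\langle x,x\rangle=-1\}$, with induced pseudo-Riemannian metrics; the ambient space is denoted $\mathbb{V}$. The conformal gradient field on $M$ with pole vector $a\in\mathbb{V}$ is $\sigma=\operatorname{grad}\alpha$ (gradient intrinsic to $M$), where $\alpha\colon M\to\mathbb{R}$, $\alpha(x)=\langle x,a\rangle$. Harmonicity. Let $\sigma$ be a vector field on a pseudo-Riemannian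 manifold $(M,g=\langle\cdot,\cdot\rangle)$ with Levi-Civita connection $\nabla$, and $F=\frac12\langle\sigma,\sigma\rangle$, $\nabla F=\operatorname{grad}F$, $\Delta F=-\operatorname{div}\nabla F$. For a local orthonormal frame $\{E_i\}$ with $\epsilon_i=\langle E_i,E_i\rangle=\pm1$ put $\langle\nabla\sigma,\nabla\sigma\rangle=\sum_i\epsilon_i\langle\nabla_{E_i}\sigma,\nabla_{E_i}\sigma\rangle$ and $\nabla^*\nabla\sigma=-\sum_i\epsilon_i\nabla^2_{E_i,E_i}\sigma$. Then $\sigma$ is $(p,q)$-harmonic if $\tau_{p,q}(\sigma)=0$ identically on $M$, where $$\tau_{p,q}(\sigma)=(1+2F)\nabla^*\nabla\sigma+2p\nabla_{\nabla F}\sigma-\bigl(p\langle\nabla\sigma,\nabla\sigma\rangle-pq\,g(\nabla F,\nabla F)-q(1+2F)\Delta F\bigr)\sigma .$$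
   Formalization: The pole vector a is assumed nonzero: for a = 0 the field σ is zero and is (p,q)-harmonic for all p, q, while μ = 0 never equals 1/(n−2), so part (1) fails there; nonzero null pole vectors are included. *)

theory Defs
  imports "HOL-Analysis.Analysis"
begin

section \<open>Pseudo-Euclidean space and its hyperquadrics\<close>

text \<open>The space with scalar product of index \<open>u\<close> is \<open>real ^ 'm\<close> with a linearly ordered index
  type: the last \<open>u\<close> coordinates carry the minus sign. The number \<open>card {..<i}\<close> is the position of
  the coordinate \<open>i\<close>, counted from 0.\<close>

type_synonym 'm rvec = "(real, 'm) vec"

definition pinner :: "nat \<Rightarrow> 'm rvec \<Rightarrow> ('m :: {finite,linorder}) rvec \<Rightarrow> real" where
  "pinner u x y =
     (\<Sum>i | card {..<i} < CARD('m) - u. x $ i * y $ i)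
   - (\<Sum>i | \<not> card {..<i} < CARD('m) - u. x $ i * y $ i)"

definition pseudo_sphere :: "nat \<Rightarrow> ('m :: {finite,linorder}) rvec set" where
  "pseudo_sphere v = {x. pinner v x x = 1}"

definition pseudo_hyperbolic :: "nat \<Rightarrow> ('m :: {finite,linorder}) rvec set" where
  "pseudo_hyperbolic v = {x. pinner (v + 1) x x = - 1}"

section \<open>Calculus on submanifolds\<close>

text \<open>In this section \<open>N\<close> stands for an embedded submanifold, given as a subset of the ambient
  space. Functions and vector fields on \<open>N\<close> are total functions on the ambient space of which only
  the values on \<open>N\<close> matter.\<close>

primrec Ck_on :: "nat \<Rightarrow> ('a :: real_normed_vector \<Rightarrow> 'b :: real_normed_vector) \<Rightarrow> 'a set \<Rightarrow> bool" where
  "Ck_on 0 f U \<longleftrightarrow> continuous_on U f"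
| "Ck_on (Suc k) f U \<longleftrightarrow>
     f differentiable_on U \<and> (\<forall>v. Ck_on k (\<lambda>x. frechet_derivative f (at x) v) U)"

definition smooth_on_submanifold ::
    "'a :: real_normed_vector set \<Rightarrow> ('a \<Rightarrow> 'b :: real_normed_vector) \<Rightarrow> bool" where
  "smooth_on_submanifold N f \<longleftrightarrow>
     (\<forall>x\<in>N. \<exists>U g. open U \<and> x \<in> U \<and> (\<forall>k. Ck_on k g U) \<and> (\<forall>y \<in> U \<inter> N. g y = f y))"

definition tangent_space :: "'a :: real_normed_vector set \<Rightarrow> 'a \<Rightarrow> 'a set" where
  "tangent_space N x =
     {w. \<exists>\<gamma> :: real \<Rightarrow> 'a. (\<forall>t. \<gamma> t \<in> N) \<and> \<gamma> 0 = x \<and> (\<gamma> has_vector_derivative w) (at 0)}"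

definition vector_fields :: "'a :: real_normed_vector set \<Rightarrow> ('a \<Rightarrow> 'a) set" where
  "vector_fields N = {X. smooth_on_submanifold N X \<and> (\<forall>x\<in>N. X x \<in> tangent_space N x)}"

text \<open>The derivative \<open>X f\<close> of a function \<open>f\<close> on \<open>N\<close> along a vector field \<open>X\<close>. A linear map witnessing
  \<open>has_derivative\<close> at \<open>x\<close> within \<open>N\<close> is in general not unique, but its values on tangent vectors
  are, so \<open>frechet_derivative\<close> is the differential of \<open>f\<close> on the tangent space.\<close>

definition deriv_along ::
    "'a :: real_normed_vector set \<Rightarrow> ('a \<Rightarrow> 'a) \<Rightarrow> ('a \<Rightarrow> 'b :: real_normed_vector) \<Rightarrow> 'a \<Rightarrow> 'b" where
  "deriv_along N X f x = frechet_derivative f (at x within N) (X x)"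

section \<open>Pseudo-Riemannian geometry of the induced metric\<close>

definition grad :: "nat \<Rightarrow> 'm rvec set \<Rightarrow> ('m rvec \<Rightarrow> real) \<Rightarrow> 'm rvec \<Rightarrow> ('m :: {finite,linorder}) rvec" where
  "grad u N f x =
     (THE w. w \<in> tangent_space N x \<and>
        (\<forall>z \<in> tangent_space N x. pinner u w z = frechet_derivative f (at x within N) z))"

text \<open>The last conjunct says that the torsion vanishes: the left-hand side is the derivative of \<open>f\<close>
  along \<open>nabla X Y - nabla Y X\<close>, the right-hand side is the one along the Lie bracket of \<open>X\<close> and
  \<open>Y\<close>.\<close>

definition levi_civita ::
    "nat \<Rightarrow> 'm rvec set
     \<Rightarrow> (('m rvec \<Rightarrow> 'm rvec) \<Rightarrow> ('m rvec \<Rightarrow> 'm rvec) \<Rightarrow> 'm rvec \<Rightarrow> ('m :: {finite,linorder}) rvec)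
     \<Rightarrow> bool" where
  "levi_civita u N nabla \<longleftrightarrow>
     (\<forall>X \<in> vector_fields N. \<forall>Y \<in> vector_fields N. nabla X Y \<in> vector_fields N) \<and>
     (\<forall>X \<in> vector_fields N. \<forall>Y \<in> vector_fields N. \<forall>Z \<in> vector_fields N. \<forall>x\<in>N.
        nabla (\<lambda>y. X y + Y y) Z x = nabla X Z x + nabla Y Z x \<and>
        nabla X (\<lambda>y. Y y + Z y) x = nabla X Y x + nabla X Z x \<and>
        deriv_along N X (\<lambda>y. pinner u (Y y) (Z y)) x
          = pinner u (nabla X Y x) (Z x) + pinner u (Y x) (nabla X Z x)) \<and>
     (\<forall>X \<in> vector_fields N. \<forall>Y \<in> vector_fields N. \<forall>f :: 'm rvec \<Rightarrow> real.
        smooth_on_submanifold N f \<longrightarrow> (\<forall>x\<in>N.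
          nabla (\<lambda>y. f y *\<^sub>R X y) Y x = f x *\<^sub>R nabla X Y x \<and>
          nabla X (\<lambda>y. f y *\<^sub>R Y y) x = deriv_along N X f x *\<^sub>R Y x + f x *\<^sub>R nabla X Y x \<and>
          deriv_along N (nabla X Y) f x - deriv_along N (nabla Y X) f x
            = deriv_along N X (deriv_along N Y f) x - deriv_along N Y (deriv_along N X f) x))"

definition orthonormal_frame ::
    "nat \<Rightarrow> 'm rvec set \<Rightarrow> nat \<Rightarrow> (nat \<Rightarrow> 'm rvec \<Rightarrow> ('m :: {finite,linorder}) rvec) \<Rightarrow> (nat \<Rightarrow> real) \<Rightarrow> bool" where
  "orthonormal_frame u N d E \<epsilon> \<longleftrightarrow>
     (\<forall>i<d. E i \<in> vector_fields N \<and> (\<epsilon> i = 1 \<or> \<epsilon> i = - 1)) \<and>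
     (\<forall>x\<in>N. (\<forall>i<d. \<forall>j<d. pinner u (E i x) (E j x) = (if i = j then \<epsilon> i else 0)) \<and>
            span ((\<lambda>i. E i x) ` {..<d}) = tangent_space N x)"

text \<open>The tension field on a submanifold \<open>N\<close> that carries a global orthonormal frame \<open>E\<close> with signs
  \<open>\<epsilon>\<close>; \<open>nabla\<close> is its Levi-Civita connection. The divergence is the metric trace of the covariant
  derivative, and the Laplacian is minus the divergence of the gradient.\<close>

context
  fixes u :: nat
    and N :: "('m :: {finite,linorder}) rvec set"
    and nabla :: "('m rvec \<Rightarrow> 'm rvec) \<Rightarrow> ('m rvec \<Rightarrow> 'm rvec) \<Rightarrow> 'm rvec \<Rightarrow> 'm rvec"
    and d :: nat and E :: "nat \<Rightarrow> 'm rvec \<Rightarrow> 'm rvec" and \<epsilon> :: "nat \<Rightarrow> real"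
begin

definition divergence :: "('m rvec \<Rightarrow> 'm rvec) \<Rightarrow> 'm rvec \<Rightarrow> real" where
  "divergence X x = (\<Sum>i<d. \<epsilon> i * pinner u (nabla (E i) X x) (E i x))"

definition laplacian :: "('m rvec \<Rightarrow> real) \<Rightarrow> 'm rvec \<Rightarrow> real" where
  "laplacian f x = - divergence (grad u N f) x"

definition second_cov ::
    "('m rvec \<Rightarrow> 'm rvec) \<Rightarrow> ('m rvec \<Rightarrow> 'm rvec) \<Rightarrow> ('m rvec \<Rightarrow> 'm rvec) \<Rightarrow> 'm rvec \<Rightarrow> 'm rvec" where
  "second_cov X Y \<sigma> x = nabla X (nabla Y \<sigma>) x - nabla (nabla X Y) \<sigma> x"

definition rough_laplacian :: "('m rvec \<Rightarrow> 'm rvec) \<Rightarrow> 'm rvec \<Rightarrow> 'm rvec" where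
  "rough_laplacian \<sigma> x = - (\<Sum>i<d. \<epsilon> i *\<^sub>R second_cov (E i) (E i) \<sigma> x)"

definition cov_norm :: "('m rvec \<Rightarrow> 'm rvec) \<Rightarrow> 'm rvec \<Rightarrow> real" where
  "cov_norm \<sigma> x = (\<Sum>i<d. \<epsilon> i * pinner u (nabla (E i) \<sigma> x) (nabla (E i) \<sigma> x))"

definition tension :: "real \<Rightarrow> real \<Rightarrow> ('m rvec \<Rightarrow> 'm rvec) \<Rightarrow> 'm rvec \<Rightarrow> 'm rvec" where
  "tension p q \<sigma> x =
     (let F = (\<lambda>y. pinner u (\<sigma> y) (\<sigma> y) / 2) in
      (1 + 2 * F x) *\<^sub>R rough_laplacian \<sigma> x
      + (2 * p) *\<^sub>R nabla (grad u N F) \<sigma> x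
      - (p * cov_norm \<sigma> x
         - p * q * pinner u (grad u N F x) (grad u N F x)
         - q * (1 + 2 * F x) * laplacian F x) *\<^sub>R \<sigma> x)"

end

text \<open>All ingredients of the tension field are local, and independent of the orthonormal frame. It is
  therefore evaluated on the relatively open pieces \<open>M \<inter> U\<close> that admit an orthonormal frame; these
  cover \<open>M\<close>, and each has exactly one Levi-Civita connection.\<close>

definition pq_harmonic ::
    "nat \<Rightarrow> 'm rvec set \<Rightarrow> real \<Rightarrow> real \<Rightarrow> ('m rvec \<Rightarrow> ('m :: {finite,linorder}) rvec) \<Rightarrow> bool" where
  "pq_harmonic u M p q \<sigma> \<longleftrightarrow>
     (\<forall>U nabla d E \<epsilon>.
        open U \<and> levi_civita u (M \<inter> U) nabla \<and> orthonormal_frame u (M \<inter> U) d E \<epsilon> \<longrightarrow>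
        (\<forall>x \<in> M \<inter> U. tension u (M \<inter> U) nabla d E \<epsilon> p q \<sigma> x = 0))"

definition conformal_gradient_field ::
    "nat \<Rightarrow> 'm rvec set \<Rightarrow> 'm rvec \<Rightarrow> 'm rvec \<Rightarrow> ('m :: {finite,linorder}) rvec" where
  "conformal_gradient_field u M a = grad u M (\<lambda>x. pinner u x a)"

end

theory Submission
  imports Defs
begin

text \<open>Write \<open>\<langle>_, _\<rangle>\<close> for the scalar product, \<open>\<kappa> = \<plusminus>1\<close> for the value \<open>\<langle>x, x\<rangle>\<close> on the hyperquadric and
  \<open>\<alpha> = \<langle>a, x\<rangle>\<close>. The conformal gradient field is the tangential projection \<open>\<sigma> = a - \<kappa> \<alpha> x\<close> of its pole
  vector, and its covariant derivative along \<open>X\<close> is \<open>- \<kappa> \<alpha> X\<close>. Everything in the tension field follows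
  from this: it equals \<open>P(\<alpha>\<^sup>2) \<sigma>\<close> with

  \<open>P(t) = \<kappa> (1 + \<mu>) (1 + q \<mu>) + (p (2 - n) - 1 + p q \<mu> - q (1 + \<mu>) (n + 1) - q \<mu>) t + \<kappa> q (n + 1 - p) t\<^sup>2\<close>

  (lemma \<open>tension_eq\<close>). As \<open>\<alpha>\<close> takes infinitely many values at points where \<open>\<sigma>\<close> does not vanish (lemma
  \<open>infinitely_many_values\<close>), the field is harmonic iff the three coefficients of \<open>P\<close> vanish (theorem
  \<open>pq_harmonic_iff\<close>). These are the same conditions for both signs of \<open>\<kappa>\<close>; solving them gives one
  solution with \<open>\<mu> > 0\<close> and two with \<open>\<mu> = - 1\<close> (lemma \<open>coefficients_vanish_iff\<close>).

  Harmonicity is tested on the open pieces that have an orthonormal frame, with their Levi-Civita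
  connection. To evaluate the tension field there, the connection must be known explicitly: it is
  the tangential part of the ambient derivative (theorem \<open>levi_civita_unique\<close>), and the trace over the
  frame does not depend on the frame (lemmas \<open>frame_expansion\<close>, \<open>frame_dimension\<close>). To draw a
  conclusion from harmonicity, there must be a piece with a connection and a frame at all. That
  the explicit formula is a Levi-Civita connection (theorem \<open>levi_civita_exists\<close>) rests on the
  symmetry of second derivatives, and a frame is obtained by reflecting the standard basis (lemma
  \<open>orthonormal_frame_exists\<close>). All of this is local, so it is carried out on an
  arbitrary relatively open piece, in the locale \<open>hyperquadric_patch\<close>.\<close>

section \<open>Smooth maps on open sets\<close>

definition smooth_on ::
    "'a :: real_normed_vector set \<Rightarrow> ('a \<Rightarrow> 'b :: real_normed_vector) \<Rightarrow> bool" where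
  "smooth_on U f \<longleftrightarrow> (\<forall>k. Ck_on k f U)"

lemma Ck_on_SucD: "Ck_on (Suc k) f U \<Longrightarrow> Ck_on k f U"
proof (induction k arbitrary: f)
  case 0
  then show ?case by (simp add: differentiable_imp_continuous_on)
next
  case (Suc k)
  have *: "f differentiable_on U \<and> (\<forall>v. Ck_on (Suc k) (\<lambda>x. frechet_derivative f (at x) v) U)"
    using Suc.prems unfolding Ck_on.simps(2)[of "Suc k" f] .
  have "Ck_on k (\<lambda>x. frechet_derivative f (at x) v) U" for v
    by (rule Suc.IH[OF *[THEN conjunct2, THEN spec]])
  with * show ?case
    unfolding Ck_on.simps(2)[of k f] by simp
qed

lemma Ck_on_Suc_differentiable:
  assumes "Ck_on (Suc k) f U" "open U" "x \<in> U"
  shows "f differentiable at x"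
  using assms unfolding Ck_on.simps(2) differentiable_on_def by (metis at_within_open)

lemma Ck_on_cong:
  fixes f g :: "'a :: real_normed_vector \<Rightarrow> 'b :: real_normed_vector"
  assumes "open U" and "\<forall>x\<in>U. f x = g x" and "Ck_on k f U"
  shows "Ck_on k g U"
  using assms(2,3)
proof (induction k arbitrary: f g)
  case 0
  then show ?case using continuous_on_eq[of U f g] by simp
next
  case (Suc k)
  have D: "(g has_derivative frechet_derivative f (at x)) (at x)" if "x \<in> U" for x
    using Ck_on_Suc_differentiable[OF Suc.prems(2) assms(1) that, unfolded frechet_derivative_works]
      assms(1) that by (rule has_derivative_transform_within_open) (use Suc.prems(1) in simp)
  have "g differentiable (at x within U)" if "x \<in> U" for x
    using differentiableI[OF D[OF that]] by (rule differentiable_at_withinI)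
  then have "g differentiable_on U"
    by (simp add: differentiable_on_def)
  moreover have "Ck_on k (\<lambda>x. frechet_derivative g (at x) v) U" for v
  proof (rule Suc.IH, rule ballI)
    show "frechet_derivative f (at x) v = frechet_derivative g (at x) v" if "x \<in> U" for x
      by (rule fun_cong[OF frechet_derivative_at[OF D[OF that]]])
    show "Ck_on k (\<lambda>x. frechet_derivative f (at x) v) U"
      using Suc.prems(2) by simp
  qed
  ultimately show ?case by simp
qed

lemma Ck_on_SucI:
  assumes "open U"
    and "\<And>x. x \<in> U \<Longrightarrow> (f has_derivative f' x) (at x)"
    and "\<And>v. Ck_on k (\<lambda>x. f' x v) U"
  shows "Ck_on (Suc k) f U"
proof -
  have "f differentiable (at x within U)" if "x \<in> U" for x
    using differentiableI[OF assms(2)[OF that]] by (rule differentiable_at_withinI)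
  then have "f differentiable_on U"
    by (simp add: differentiable_on_def)
  moreover have "Ck_on k (\<lambda>x. frechet_derivative f (at x) v) U" for v
  proof (rule Ck_on_cong[OF assms(1) _ assms(3)[of v]], rule ballI)
    show "f' x v = frechet_derivative f (at x) v" if "x \<in> U" for x
      by (rule fun_cong[OF frechet_derivative_at[OF assms(2)[OF that]]])
  qed
  ultimately show ?thesis by simp
qed

lemma Ck_on_subset:
  assumes "Ck_on k f U" "V \<subseteq> U"
  shows "Ck_on k f V"
  using assms(1)
proof (induction k arbitrary: f)
  case 0
  then show ?case using continuous_on_subset[OF _ assms(2)] by simp
next
  case (Suc k)
  then show ?case using differentiable_on_subset[OF _ assms(2), of f] by simp
qed

lemma Ck_on_const: "Ck_on k (\<lambda>x. c) U"
  by (induction k arbitrary: c) auto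

lemma Ck_on_bounded_linear:
  assumes "bounded_linear L" "open U"
  shows "Ck_on k L U"
proof (cases k)
  case 0
  then show ?thesis
    using assms by (simp add: linear_continuous_on)
next
  case (Suc j)
  show ?thesis unfolding Suc
    by (rule Ck_on_SucI[where f' = "\<lambda>x. L"])
      (use assms in \<open>auto simp: bounded_linear_imp_has_derivative Ck_on_const\<close>)
qed

lemma Ck_on_add:
  assumes "open U" "Ck_on k f U" "Ck_on k g U"
  shows "Ck_on k (\<lambda>x. f x + g x) U"
  using assms(2,3)
proof (induction k arbitrary: f g)
  case 0
  then show ?case by (simp add: continuous_on_add)
next
  case (Suc k)
  have "((\<lambda>x. f x + g x) has_derivative
      (\<lambda>v. frechet_derivative f (at x) v + frechet_derivative g (at x) v)) (at x)" if "x \<in> U" for x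
    using Suc.prems[THEN Ck_on_Suc_differentiable, OF assms(1) that, unfolded frechet_derivative_works]
    by (rule has_derivative_add)
  then show ?case
    by (rule Ck_on_SucI[OF assms(1)]) (use Suc in simp_all)
qed

lemma Ck_on_bilinear:
  assumes "bounded_bilinear b" "open U" "Ck_on k f U" "Ck_on k g U"
  shows "Ck_on k (\<lambda>x. b (f x) (g x)) U"
  using assms(3,4)
proof (induction k arbitrary: f g)
  case 0
  then show ?case by (simp add: bounded_bilinear.continuous_on[OF assms(1)])
next
  case (Suc k)
  have "((\<lambda>x. b (f x) (g x)) has_derivative
      (\<lambda>v. b (f x) (frechet_derivative g (at x) v) + b (frechet_derivative f (at x) v) (g x)))
      (at x)" if "x \<in> U" for x
    using Suc.prems[THEN Ck_on_Suc_differentiable, OF assms(2) that, unfolded frechet_derivative_works]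
    by (rule bounded_bilinear.FDERIV[OF assms(1)])
  then show ?case
    by (rule Ck_on_SucI[OF assms(2)])
      (use Suc Ck_on_SucD[OF Suc.prems(1)] Ck_on_SucD[OF Suc.prems(2)] in
        \<open>simp_all add: Ck_on_add[OF assms(2)]\<close>)
qed

lemma Ck_on_inverse:
  fixes f :: "'a :: real_normed_vector \<Rightarrow> real"
  assumes "open U" "\<And>x. x \<in> U \<Longrightarrow> f x \<noteq> 0" "Ck_on k f U"
  shows "Ck_on k (\<lambda>x. inverse (f x)) U"
  using assms(3)
proof (induction k)
  case 0
  then show ?case using assms(2) by (simp add: continuous_on_inverse)
next
  case (Suc k)
  have "((\<lambda>x. inverse (f x)) has_derivative
      (\<lambda>v. (inverse (f x) * inverse (f x)) * ((-1) * frechet_derivative f (at x) v))) (at x)"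
    if "x \<in> U" for x
    using Suc.prems[THEN Ck_on_Suc_differentiable, OF assms(1) that, unfolded frechet_derivative_works]
    by (auto intro!: derivative_eq_intros simp: assms(2)[OF that] mult_ac)
  then show ?case
  proof (rule Ck_on_SucI[OF assms(1)])
    show "Ck_on k (\<lambda>x. (inverse (f x) * inverse (f x)) * ((-1) * frechet_derivative f (at x) v)) U" for v
      using Suc Ck_on_SucD[OF Suc.prems]
      by (intro Ck_on_bilinear[OF bounded_bilinear_mult assms(1)] Ck_on_const) simp_all
  qed
qed

lemma smooth_on_const: "smooth_on U (\<lambda>x. c)"
  by (simp add: smooth_on_def Ck_on_const)

lemma smooth_on_bounded_linear: "bounded_linear L \<Longrightarrow> open U \<Longrightarrow> smooth_on U L"
  by (simp add: smooth_on_def Ck_on_bounded_linear)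

lemma smooth_on_add:
  "open U \<Longrightarrow> smooth_on U f \<Longrightarrow> smooth_on U g \<Longrightarrow> smooth_on U (\<lambda>x. f x + g x)"
  by (simp add: smooth_on_def Ck_on_add)

lemma smooth_on_sum:
  assumes "open U" "\<And>i. i \<in> I \<Longrightarrow> smooth_on U (f i)"
  shows "smooth_on U (\<lambda>x. \<Sum>i\<in>I. f i x)"
  using assms(2)
  by (induction I rule: infinite_finite_induct) (auto intro: smooth_on_const smooth_on_add[OF assms(1)])

lemma smooth_on_bilinear:
  "bounded_bilinear b \<Longrightarrow> open U \<Longrightarrow> smooth_on U f \<Longrightarrow> smooth_on U g
    \<Longrightarrow> smooth_on U (\<lambda>x. b (f x) (g x))"
  by (simp add: smooth_on_def Ck_on_bilinear)

lemma smooth_on_inverse: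
  fixes f :: "'a :: real_normed_vector \<Rightarrow> real"
  shows "open U \<Longrightarrow> (\<And>x. x \<in> U \<Longrightarrow> f x \<noteq> 0) \<Longrightarrow> smooth_on U f
    \<Longrightarrow> smooth_on U (\<lambda>x. inverse (f x))"
  by (simp add: smooth_on_def Ck_on_inverse)

lemma smooth_on_subset: "smooth_on U f \<Longrightarrow> V \<subseteq> U \<Longrightarrow> smooth_on V f"
  unfolding smooth_on_def using Ck_on_subset by blast

lemma smooth_on_has_derivative:
  assumes "smooth_on U f" "open U" "x \<in> U"
  shows "(f has_derivative frechet_derivative f (at x)) (at x)"
  using assms Ck_on_Suc_differentiable[of 0 f U x] frechet_derivative_works
  unfolding smooth_on_def by blast

lemma smooth_on_directional_derivative:
  assumes "smooth_on U f"
  shows "smooth_on U (\<lambda>x. frechet_derivative f (at x) v)"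
  using assms unfolding smooth_on_def by (metis Ck_on.simps(2))

lemma smooth_on_continuous: "smooth_on U f \<Longrightarrow> continuous_on U f"
  unfolding smooth_on_def by (metis Ck_on.simps(1))

text \<open>Two applications of the mean value theorem turn the second difference of \<open>f\<close> over a small
  parallelogram into a second derivative at some nearby point.\<close>

lemma second_difference_mean_value:
  fixes f :: "'a :: real_normed_vector \<Rightarrow> real"
  assumes f: "smooth_on U f" and "open U" and "0 < t"
    and U: "\<And>r s. 0 \<le> r \<Longrightarrow> r \<le> t \<Longrightarrow> 0 \<le> s \<Longrightarrow> s \<le> t \<Longrightarrow> x + r *\<^sub>R v + s *\<^sub>R w \<in> U"
  obtains r s where "0 \<le> r" "r \<le> t" "0 \<le> s" "s \<le> t"
    and "f (x + t *\<^sub>R v + t *\<^sub>R w) - f (x + t *\<^sub>R v) - f (x + t *\<^sub>R w) + f x =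
      t\<^sup>2 * frechet_derivative (\<lambda>y. frechet_derivative f (at y) v) (at (x + r *\<^sub>R v + s *\<^sub>R w)) w"
proof -
  let ?D = "\<lambda>g y. frechet_derivative g (at y)"
  let ?g = "\<lambda>y. ?D f y v"
  have D: "((\<lambda>r. g (y + r *\<^sub>R z)) has_real_derivative ?D g (y + r *\<^sub>R z) z) (at r)"
    if "smooth_on U g" "y + r *\<^sub>R z \<in> U" for g :: "'a \<Rightarrow> real" and y z r
  proof -
    have "((\<lambda>r. y + r *\<^sub>R z) has_derivative (\<lambda>h. h *\<^sub>R z)) (at r)"
      by (auto intro!: derivative_eq_intros)
    from has_derivative_compose[OF this smooth_on_has_derivative[OF that(1) \<open>open U\<close> that(2)]]
    have "((\<lambda>r. g (y + r *\<^sub>R z)) has_derivative (\<lambda>h. ?D g (y + r *\<^sub>R z) (h *\<^sub>R z))) (at r)" .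
    moreover have "?D g (y + r *\<^sub>R z) (h *\<^sub>R z) = h * ?D g (y + r *\<^sub>R z) z" for h
      using has_derivative_linear[OF smooth_on_has_derivative[OF that(1) \<open>open U\<close> that(2)]]
      by (simp add: linear_cmul)
    ultimately show ?thesis
      by (simp add: has_field_derivative_def mult_commute_abs)
  qed
  have "\<exists>r>0. r < t \<and> (f (x + t *\<^sub>R w + t *\<^sub>R v) - f (x + t *\<^sub>R v))
      - (f (x + t *\<^sub>R w + 0 *\<^sub>R v) - f (x + 0 *\<^sub>R v))
      = (t - 0) * (?D f (x + t *\<^sub>R w + r *\<^sub>R v) v - ?D f (x + r *\<^sub>R v) v)"
  proof (rule MVT2[OF \<open>0 < t\<close>])
    fix r assume "0 \<le> r" "r \<le> t"
    then have "x + t *\<^sub>R w + r *\<^sub>R v \<in> U" "x + r *\<^sub>R v \<in> U"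
      using U[of r t] U[of r 0] \<open>0 < t\<close> by (auto simp: add_ac)
    then show "((\<lambda>r. f (x + t *\<^sub>R w + r *\<^sub>R v) - f (x + r *\<^sub>R v)) has_real_derivative
        ?D f (x + t *\<^sub>R w + r *\<^sub>R v) v - ?D f (x + r *\<^sub>R v) v) (at r)"
      by (intro DERIV_diff D f)
  qed
  then obtain r where r: "0 < r" "r < t" and
    1: "f (x + t *\<^sub>R w + t *\<^sub>R v) - f (x + t *\<^sub>R v) - (f (x + t *\<^sub>R w) - f x)
      = t * (?g (x + t *\<^sub>R w + r *\<^sub>R v) - ?g (x + r *\<^sub>R v))"
    by auto
  have "\<exists>s>0. s < t \<and> ?g (x + r *\<^sub>R v + t *\<^sub>R w) - ?g (x + r *\<^sub>R v + 0 *\<^sub>R w)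
      = (t - 0) * ?D ?g (x + r *\<^sub>R v + s *\<^sub>R w) w"
  proof (rule MVT2[OF \<open>0 < t\<close>])
    fix s assume "0 \<le> s" "s \<le> t"
    then have "x + r *\<^sub>R v + s *\<^sub>R w \<in> U" using U r by auto
    then show "((\<lambda>s. ?g (x + r *\<^sub>R v + s *\<^sub>R w)) has_real_derivative
        ?D ?g (x + r *\<^sub>R v + s *\<^sub>R w) w) (at s)"
      by (intro D smooth_on_directional_derivative f)
  qed
  then obtain s where s: "0 < s" "s < t" and
    2: "?g (x + r *\<^sub>R v + t *\<^sub>R w) - ?g (x + r *\<^sub>R v) = t * ?D ?g (x + r *\<^sub>R v + s *\<^sub>R w) w"
    by auto
  show thesis
    by (rule that[of r s]) (use r s 1 2 in \<open>auto simp: power2_eq_square add_ac algebra_simps\<close>)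
qed

text \<open>The second difference is symmetric in \<open>v\<close> and \<open>w\<close>, so the two mixed derivatives agree at points
  that tend to \<open>x\<close> with the size of the parallelogram; they are continuous, hence agree at \<open>x\<close>.\<close>

theorem second_derivative_symmetric:
  fixes f :: "'a :: real_normed_vector \<Rightarrow> real"
  assumes f: "smooth_on U f" and "open U" and "x \<in> U"
  shows "frechet_derivative (\<lambda>y. frechet_derivative f (at y) v) (at x) w =
    frechet_derivative (\<lambda>y. frechet_derivative f (at y) w) (at x) v"
proof (rule dense_eq0_I[THEN eq_iff_diff_eq_0[THEN iffD2]])
  define H where "H v w y = frechet_derivative (\<lambda>z. frechet_derivative f (at z) v) (at y) w" for v w y
  fix e :: real assume "0 < e"
  have lim: "\<exists>d>0. \<forall>y. dist y x < d \<longrightarrow> y \<in> U \<and> dist (H v w y) (H v w x) < e / 2" for v w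
  proof -
    have "continuous_on U (H v w)"
      unfolding H_def
      by (intro smooth_on_continuous smooth_on_directional_derivative f)
    then obtain d1 where "d1 > 0" "\<forall>y\<in>U. dist y x < d1 \<longrightarrow> dist (H v w y) (H v w x) < e / 2"
      using \<open>x \<in> U\<close> \<open>0 < e\<close> unfolding continuous_on_iff by (meson half_gt_zero)
    moreover obtain d2 where "d2 > 0" "\<forall>y. dist y x < d2 \<longrightarrow> y \<in> U"
      using \<open>open U\<close> \<open>x \<in> U\<close> unfolding open_dist by blast
    ultimately show ?thesis by (intro exI[of _ "min d1 d2"]) auto
  qed
  obtain d1 where d1: "d1 > 0" "\<And>y. dist y x < d1 \<Longrightarrow> y \<in> U \<and> dist (H v w y) (H v w x) < e / 2"
    using lim[of v w] by blast
  obtain d2 where d2: "d2 > 0" "\<And>y. dist y x < d2 \<Longrightarrow> y \<in> U \<and> dist (H w v y) (H w v x) < e / 2"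
    using lim[of w v] by blast
  \<comment> \<open>So small that the whole parallelogram lies within \<open>d1\<close> and \<open>d2\<close> of \<open>x\<close>.\<close>
  define t where "t = min d1 d2 / (2 * (norm v + norm w + 1))"
  have "t > 0" using d1 d2 by (simp add: t_def divide_pos_pos add_nonneg_pos)
  have near: "dist (x + r *\<^sub>R v' + s *\<^sub>R w') x < min d1 d2"
    if "0 \<le> r" "r \<le> t" "0 \<le> s" "s \<le> t" "{v', w'} = {v, w}" for r s v' w'
  proof -
    have "dist (x + r *\<^sub>R v' + s *\<^sub>R w') x \<le> \<bar>r\<bar> * norm v' + \<bar>s\<bar> * norm w'"
      unfolding dist_norm using norm_triangle_ineq[of "r *\<^sub>R v'" "s *\<^sub>R w'"] by (simp add: algebra_simps)
    also have "\<dots> \<le> t * norm v' + t * norm w'"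
      using that by (intro add_mono mult_right_mono) auto
    also have "\<dots> = t * (norm v + norm w)"
      using that(5) by (auto simp: doubleton_eq_iff algebra_simps)
    also have "\<dots> < t * (2 * (norm v + norm w + 1))"
    proof (rule mult_strict_left_mono[OF _ \<open>t > 0\<close>])
      show "norm v + norm w < 2 * (norm v + norm w + 1)"
        by (smt (verit) norm_ge_zero)
    qed
    also have "\<dots> = min d1 d2"
    proof -
      have "2 * (norm v + norm w + 1) \<noteq> 0"
        by (smt (verit) norm_ge_zero)
      then show ?thesis by (simp add: t_def)
    qed
    finally show ?thesis .
  qed
  obtain r s where 1: "0 \<le> r" "r \<le> t" "0 \<le> s" "s \<le> t" and
    e1: "f (x + t *\<^sub>R v + t *\<^sub>R w) - f (x + t *\<^sub>R v) - f (x + t *\<^sub>R w) + f x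
      = t\<^sup>2 * H v w (x + r *\<^sub>R v + s *\<^sub>R w)"
    unfolding H_def
    by (rule second_difference_mean_value[OF f \<open>open U\<close> \<open>t > 0\<close>, of x v w])
      (use near[of _ _ v w] d1(2) in auto)
  obtain r' s' where 2: "0 \<le> r'" "r' \<le> t" "0 \<le> s'" "s' \<le> t" and
    e2: "f (x + t *\<^sub>R w + t *\<^sub>R v) - f (x + t *\<^sub>R w) - f (x + t *\<^sub>R v) + f x
      = t\<^sup>2 * H w v (x + r' *\<^sub>R w + s' *\<^sub>R v)"
    unfolding H_def
    by (rule second_difference_mean_value[OF f \<open>open U\<close> \<open>t > 0\<close>, of x w v])
      (use near[of _ _ w v] d2(2) in \<open>auto simp: insert_commute\<close>)
  have "t\<^sup>2 * H v w (x + r *\<^sub>R v + s *\<^sub>R w) = t\<^sup>2 * H w v (x + r' *\<^sub>R w + s' *\<^sub>R v)"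
    unfolding e1[symmetric] e2[symmetric] by (simp add: add_ac)
  then have "H v w (x + r *\<^sub>R v + s *\<^sub>R w) = H w v (x + r' *\<^sub>R w + s' *\<^sub>R v)"
    using \<open>t > 0\<close> by simp
  moreover have "dist (H v w (x + r *\<^sub>R v + s *\<^sub>R w)) (H v w x) < e / 2"
    using d1(2) near[OF 1] by auto
  moreover have "dist (H w v (x + r' *\<^sub>R w + s' *\<^sub>R v)) (H w v x) < e / 2"
    using d2(2) near[OF 2] by auto
  ultimately show "\<bar>frechet_derivative (\<lambda>y. frechet_derivative f (at y) v) (at x) w -
    frechet_derivative (\<lambda>y. frechet_derivative f (at y) w) (at x) v\<bar> \<le> e"
    unfolding H_def[symmetric] dist_real_def by linarith
qed

section \<open>Calculus along a submanifold\<close>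

text \<open>By the chain rule along a curve in \<open>N\<close>, a derivative within \<open>N\<close> is determined on tangent
  vectors, even if \<open>N\<close> has no interior.\<close>

lemma derivatives_within_agree_on_tangents:
  assumes "(f has_derivative f1) (at x within N)" "(f has_derivative f2) (at x within N)"
    and "w \<in> tangent_space N x"
  shows "f1 w = f2 w"
proof -
  obtain \<gamma> :: "real \<Rightarrow> 'a" where \<gamma>: "\<And>t. \<gamma> t \<in> N" "\<gamma> 0 = x" "(\<gamma> has_vector_derivative w) (at 0)"
    using assms(3) unfolding tangent_space_def by blast
  have D: "((\<lambda>t. f (\<gamma> t)) has_derivative (\<lambda>h. f' (h *\<^sub>R w))) (at 0)"
    if "(f has_derivative f') (at x within N)" for f'
  proof (rule has_derivative_in_compose[where f = \<gamma> and f' = "\<lambda>h. h *\<^sub>R w" and g = f and g' = f'])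
    show "(\<gamma> has_derivative (\<lambda>h. h *\<^sub>R w)) (at 0)"
      using \<gamma>(3) by (simp add: has_vector_derivative_def)
    show "(f has_derivative f') (at (\<gamma> 0) within range \<gamma>)"
      unfolding \<gamma>(2) by (rule has_derivative_subset[OF that]) (use \<gamma>(1) in auto)
  qed
  have "(\<lambda>h. f1 (h *\<^sub>R w)) = (\<lambda>h. f2 (h *\<^sub>R w))"
    by (rule has_derivative_unique[OF D[OF assms(1)] D[OF assms(2)]])
  from fun_cong[OF this, of 1] show ?thesis by simp
qed

lemma frechet_derivative_within_tangent:
  assumes "(f has_derivative f') (at x within N)" and "w \<in> tangent_space N x"
  shows "frechet_derivative f (at x within N) w = f' w"
  using derivatives_within_agree_on_tangents[OF _ assms] differentiableI[OF assms(1)]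
  by (simp add: frechet_derivative_works)

lemma frechet_derivative_within_cong:
  assumes "x \<in> N" and "\<And>y. y \<in> N \<Longrightarrow> f y = g y"
  shows "frechet_derivative f (at x within N) = frechet_derivative g (at x within N)"
proof -
  have "(f has_derivative D) (at x within N) \<longleftrightarrow> (g has_derivative D) (at x within N)" for D
    using assms has_derivative_transform[of x N f g] has_derivative_transform[of x N g f] by auto
  then show ?thesis by (simp add: frechet_derivative_def)
qed

lemma deriv_along_cong:
  assumes "x \<in> N" and "\<And>y. y \<in> N \<Longrightarrow> f y = g y"
  shows "deriv_along N X f x = deriv_along N X g x"
  by (simp add: deriv_along_def frechet_derivative_within_cong[OF assms])

lemma smooth_on_submanifold_iff:
  "smooth_on_submanifold N f \<longleftrightarrow>
    (\<forall>x\<in>N. \<exists>U g. open U \<and> x \<in> U \<and> smooth_on U g \<and> (\<forall>y \<in> U \<inter> N. g y = f y))"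
  unfolding smooth_on_submanifold_def smooth_on_def ..

lemma smooth_on_submanifoldI:
  assumes "\<And>x. x \<in> N \<Longrightarrow> \<exists>U g. open U \<and> x \<in> U \<and> smooth_on U g \<and> (\<forall>y \<in> U \<inter> N. g y = f y)"
  shows "smooth_on_submanifold N f"
  unfolding smooth_on_submanifold_iff using assms by (rule ballI)

lemma smooth_on_submanifoldE:
  assumes "smooth_on_submanifold N f" and "x \<in> N"
  obtains U g where "open U" "x \<in> U" "smooth_on U g" "\<forall>y \<in> U \<inter> N. g y = f y"
  using bspec[OF assms(1)[unfolded smooth_on_submanifold_iff] assms(2)] by (elim exE conjE)

lemma smooth_on_imp_smooth_on_submanifold:
  assumes "open U" "N \<subseteq> U" "smooth_on U f"
  shows "smooth_on_submanifold N f"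
proof (rule smooth_on_submanifoldI)
  show "\<exists>V g. open V \<and> x \<in> V \<and> smooth_on V g \<and> (\<forall>y \<in> V \<inter> N. g y = f y)" if "x \<in> N" for x
    using assms that by (intro exI[of _ U] exI[of _ f]) auto
qed

lemma smooth_on_submanifold_cong:
  assumes "smooth_on_submanifold N f" and "\<And>x. x \<in> N \<Longrightarrow> f x = g x"
  shows "smooth_on_submanifold N g"
proof -
  have "(\<forall>y \<in> U \<inter> N. h y = g y) \<longleftrightarrow> (\<forall>y \<in> U \<inter> N. h y = f y)" for U h
    using assms(2) by simp
  with assms(1) show ?thesis unfolding smooth_on_submanifold_iff by simp
qed

lemma has_derivative_transform_locally:
  assumes "(f has_derivative f') (at x within N)" "open U" "x \<in> U" "x \<in> N"
    and "\<And>y. y \<in> U \<Longrightarrow> y \<in> N \<Longrightarrow> f y = g y"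
  shows "(g has_derivative f') (at x within N)"
proof -
  obtain d where d: "d > 0" "\<forall>y. dist y x < d \<longrightarrow> y \<in> U"
    using assms(2,3) unfolding open_dist by blast
  show ?thesis
    by (rule has_derivative_transform_within[OF assms(1) d(1) assms(4)]) (use d(2) assms(5) in simp)
qed

lemma smooth_on_submanifold_has_derivative:
  assumes "smooth_on_submanifold N f" and "x \<in> N"
  shows "(f has_derivative frechet_derivative f (at x within N)) (at x within N)"
proof -
  obtain U g where g: "open U" "x \<in> U" "smooth_on U g" "\<forall>y \<in> U \<inter> N. g y = f y"
    by (rule smooth_on_submanifoldE[OF assms]) (rule that)
  have "(g has_derivative frechet_derivative g (at x)) (at x within N)"
    using smooth_on_has_derivative[OF g(3,1,2)] by (rule has_derivative_at_withinI)
  then have "(f has_derivative frechet_derivative g (at x)) (at x within N)"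
    by (rule has_derivative_transform_locally[OF _ g(1,2) assms(2)]) (use g(4) in simp)
  then show ?thesis
    using differentiableI frechet_derivative_works by blast
qed

lemma frechet_derivative_within_eq_extension:
  assumes "smooth_on U g" "open U" "x \<in> U" "\<forall>y \<in> U \<inter> N. g y = f y"
    and "x \<in> N" "w \<in> tangent_space N x"
  shows "frechet_derivative f (at x within N) w = frechet_derivative g (at x) w"
proof (rule frechet_derivative_within_tangent[OF _ assms(6)])
  have "(g has_derivative frechet_derivative g (at x)) (at x within N)"
    using smooth_on_has_derivative[OF assms(1-3)] by (rule has_derivative_at_withinI)
  then show "(f has_derivative frechet_derivative g (at x)) (at x within N)"
    by (rule has_derivative_transform_locally[OF _ assms(2,3,5)]) (use assms(4) in simp)
qed

lemma smooth_on_submanifold_const: "smooth_on_submanifold N (\<lambda>x. c)"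
  by (rule smooth_on_imp_smooth_on_submanifold[of UNIV]) (simp_all add: smooth_on_const)

lemma smooth_on_submanifold_bounded_linear:
  "bounded_linear L \<Longrightarrow> smooth_on_submanifold N L"
  by (rule smooth_on_imp_smooth_on_submanifold[of UNIV]) (simp_all add: smooth_on_bounded_linear)

lemma smooth_on_submanifold_bilinear:
  assumes "bounded_bilinear b" "smooth_on_submanifold N f" "smooth_on_submanifold N g"
  shows "smooth_on_submanifold N (\<lambda>x. b (f x) (g x))"
proof (rule smooth_on_submanifoldI)
  fix x assume "x \<in> N"
  obtain U f' where f: "open U" "x \<in> U" "smooth_on U f'" "\<forall>y \<in> U \<inter> N. f' y = f y"
    by (rule smooth_on_submanifoldE[OF assms(2) \<open>x \<in> N\<close>]) (rule that)
  obtain V g' where g: "open V" "x \<in> V" "smooth_on V g'" "\<forall>y \<in> V \<inter> N. g' y = g y"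
    by (rule smooth_on_submanifoldE[OF assms(3) \<open>x \<in> N\<close>]) (rule that)
  have "open (U \<inter> V)" using f(1) g(1) by (rule open_Int)
  moreover have "smooth_on (U \<inter> V) (\<lambda>x. b (f' x) (g' x))"
    using smooth_on_bilinear[OF assms(1) \<open>open (U \<inter> V)\<close>]
      smooth_on_subset[OF f(3), of "U \<inter> V"] smooth_on_subset[OF g(3), of "U \<inter> V"] by simp
  ultimately show "\<exists>U h. open U \<and> x \<in> U \<and> smooth_on U h \<and> (\<forall>y \<in> U \<inter> N. h y = b (f y) (g y))"
    using f(2,4) g(2,4) by (intro exI[of _ "U \<inter> V"] exI[of _ "\<lambda>x. b (f' x) (g' x)"]) simp
qed

lemma smooth_on_submanifold_add:
  assumes "smooth_on_submanifold N f" "smooth_on_submanifold N g"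
  shows "smooth_on_submanifold N (\<lambda>x. f x + g x)"
proof (rule smooth_on_submanifoldI)
  fix x assume "x \<in> N"
  obtain U f' where f: "open U" "x \<in> U" "smooth_on U f'" "\<forall>y \<in> U \<inter> N. f' y = f y"
    by (rule smooth_on_submanifoldE[OF assms(1) \<open>x \<in> N\<close>]) (rule that)
  obtain V g' where g: "open V" "x \<in> V" "smooth_on V g'" "\<forall>y \<in> V \<inter> N. g' y = g y"
    by (rule smooth_on_submanifoldE[OF assms(2) \<open>x \<in> N\<close>]) (rule that)
  have "open (U \<inter> V)" using f(1) g(1) by (rule open_Int)
  moreover have "smooth_on (U \<inter> V) (\<lambda>x. f' x + g' x)"
    using smooth_on_add[OF \<open>open (U \<inter> V)\<close>]
      smooth_on_subset[OF f(3), of "U \<inter> V"] smooth_on_subset[OF g(3), of "U \<inter> V"] by simp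
  ultimately show "\<exists>U h. open U \<and> x \<in> U \<and> smooth_on U h \<and> (\<forall>y \<in> U \<inter> N. h y = f y + g y)"
    using f(2,4) g(2,4) by (intro exI[of _ "U \<inter> V"] exI[of _ "\<lambda>x. f' x + g' x"]) simp
qed

lemma linear_basis_expansion:
  fixes L :: "'a :: euclidean_space \<Rightarrow> 'b :: real_vector"
  assumes "linear L"
  shows "L v = (\<Sum>b\<in>Basis. (v \<bullet> b) *\<^sub>R L b)"
proof -
  have "L v = L (\<Sum>b\<in>Basis. (v \<bullet> b) *\<^sub>R b)" by (simp add: euclidean_representation)
  also have "\<dots> = (\<Sum>b\<in>Basis. (v \<bullet> b) *\<^sub>R L b)"
    by (simp add: linear_sum[OF assms] linear_cmul[OF assms])
  finally show ?thesis .
qed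

text \<open>Smoothness only speaks of derivatives in constant directions, so the derivative along a field is
  written as a combination of derivatives along basis vectors with smooth coefficients.\<close>

lemma deriv_along_smooth:
  fixes X :: "'a :: euclidean_space \<Rightarrow> 'a" and f :: "'a \<Rightarrow> 'b :: real_normed_vector"
  assumes "X \<in> vector_fields N" "smooth_on_submanifold N f"
  shows "smooth_on_submanifold N (deriv_along N X f)"
proof (rule smooth_on_submanifoldI)
  fix x assume "x \<in> N"
  have X: "smooth_on_submanifold N X" "\<And>y. y \<in> N \<Longrightarrow> X y \<in> tangent_space N y"
    using assms(1) by (simp_all add: vector_fields_def)
  obtain U f' where f: "open U" "x \<in> U" "smooth_on U f'" "\<forall>y \<in> U \<inter> N. f' y = f y"
    by (rule smooth_on_submanifoldE[OF assms(2) \<open>x \<in> N\<close>]) (rule that)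
  obtain V Y where Y: "open V" "x \<in> V" "smooth_on V Y" "\<forall>y \<in> V \<inter> N. Y y = X y"
    by (rule smooth_on_submanifoldE[OF X(1) \<open>x \<in> N\<close>]) (rule that)
  define D where "D y = (\<Sum>b\<in>Basis. (Y y \<bullet> b) *\<^sub>R frechet_derivative f' (at y) b)" for y
  have UV: "open (U \<inter> V)" using f(1) Y(1) by (rule open_Int)
  have "smooth_on (U \<inter> V) D"
    unfolding D_def
    by (intro smooth_on_sum[OF UV] smooth_on_bilinear[OF bounded_bilinear_scaleR UV]
        smooth_on_bilinear[OF bounded_bilinear_inner UV] smooth_on_const
        smooth_on_subset[OF Y(3)] smooth_on_subset[OF smooth_on_directional_derivative[OF f(3)]]) auto
  moreover have "D y = deriv_along N X f y" if "y \<in> U \<inter> V \<inter> N" for y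
  proof -
    have "linear (frechet_derivative f' (at y))"
      using smooth_on_has_derivative[OF f(3,1), of y] that has_derivative_linear by blast
    then have "D y = frechet_derivative f' (at y) (X y)"
      using Y(4) that unfolding D_def using linear_basis_expansion[of "frechet_derivative f' (at y)" "X y"] by simp
    also have "\<dots> = deriv_along N X f y"
      using frechet_derivative_within_eq_extension[OF f(3,1) _ f(4)] X(2)[of y] f(2) that
      by (simp add: deriv_along_def)
    finally show ?thesis .
  qed
  ultimately show "\<exists>U g. open U \<and> x \<in> U \<and> smooth_on U g \<and> (\<forall>y \<in> U \<inter> N. g y = deriv_along N X f y)"
    using UV f(2) Y(2) by (intro exI[of _ "U \<inter> V"] exI[of _ D]) simp
qed

lemma deriv_along_has_derivative:
  assumes "(f has_derivative f') (at x within N)" "X x \<in> tangent_space N x"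
  shows "deriv_along N X f x = f' (X x)"
  using frechet_derivative_within_tangent[OF assms] by (simp add: deriv_along_def)

lemma deriv_along_bilinear:
  assumes "bounded_bilinear b" "smooth_on_submanifold N f" "smooth_on_submanifold N g"
    and "x \<in> N" "X x \<in> tangent_space N x"
  shows "deriv_along N X (\<lambda>y. b (f y) (g y)) x
    = b (f x) (deriv_along N X g x) + b (deriv_along N X f x) (g x)"
  using deriv_along_has_derivative[where X = X, OF bounded_bilinear.FDERIV[OF assms(1)
      smooth_on_submanifold_has_derivative[OF assms(2,4)]
      smooth_on_submanifold_has_derivative[OF assms(3,4)]] assms(5)]
  by (simp add: deriv_along_def)

lemma deriv_along_add:
  assumes "smooth_on_submanifold N f" "smooth_on_submanifold N g"
    and "x \<in> N" "X x \<in> tangent_space N x"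
  shows "deriv_along N X (\<lambda>y. f y + g y) x = deriv_along N X f x + deriv_along N X g x"
  using deriv_along_has_derivative[where X = X, OF has_derivative_add[OF
      smooth_on_submanifold_has_derivative[OF assms(1,3)]
      smooth_on_submanifold_has_derivative[OF assms(2,3)]] assms(4)]
  by (simp add: deriv_along_def)

lemma deriv_along_bounded_linear:
  assumes "bounded_linear L" and "X x \<in> tangent_space N x"
  shows "deriv_along N X L x = L (X x)"
  by (rule deriv_along_has_derivative[where X = X, OF _ assms(2)])
    (rule bounded_linear_imp_has_derivative[OF assms(1)])

lemma deriv_along_const:
  assumes "X x \<in> tangent_space N x"
  shows "deriv_along N X (\<lambda>y. c) x = 0"
  using deriv_along_has_derivative[where X = X, OF has_derivative_const[of c] assms] by simp

lemma linear_frechet_derivative_within: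
  assumes "smooth_on_submanifold N f" and "x \<in> N"
  shows "linear (frechet_derivative f (at x within N))"
  using has_derivative_linear[OF smooth_on_submanifold_has_derivative[OF assms]] .

text \<open>The part of \<open>X (Y f)\<close> that remains after differentiating \<open>Y\<close> is the Hessian of an extension
  \<open>g\<close>, which is symmetric; it will drop out of the commutator of \<open>X\<close> and \<open>Y\<close>. The vector
  \<open>deriv_along N X Y x\<close> need not be tangent, which is why \<open>g\<close> and not \<open>f\<close> is applied to it.\<close>

lemma second_deriv_along:
  fixes X Y :: "'a :: euclidean_space \<Rightarrow> 'a" and f g :: "'a \<Rightarrow> real"
  assumes X: "X \<in> vector_fields N" and Y: "Y \<in> vector_fields N" and "x \<in> N"
    and g: "smooth_on U g" "open U" "x \<in> U" and gf: "\<forall>y \<in> U \<inter> N. g y = f y"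
  shows "deriv_along N X (deriv_along N Y f) x =
    frechet_derivative g (at x) (deriv_along N X Y x)
    + frechet_derivative (\<lambda>y. frechet_derivative g (at y) (X x)) (at x) (Y x)"
proof -
  let ?D = "\<lambda>y. frechet_derivative g (at y)"
  let ?H = "\<lambda>v. frechet_derivative (\<lambda>y. ?D y v) (at x)"
  let ?DY = "frechet_derivative Y (at x within N)"
  have tY: "Y y \<in> tangent_space N y" if "y \<in> N" for y
    using Y that by (simp add: vector_fields_def)
  have tX: "X x \<in> tangent_space N x"
    using X \<open>x \<in> N\<close> by (simp add: vector_fields_def)
  have lin: "linear (?D y)" if "y \<in> U" for y
    using smooth_on_has_derivative[OF g(1,2) that] has_derivative_linear by blast
  have DY: "(Y has_derivative ?DY) (at x within N)"
    using Y by (intro smooth_on_submanifold_has_derivative \<open>x \<in> N\<close>) (simp add: vector_fields_def)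
  have H: "((\<lambda>y. ?D y b) has_derivative ?H b) (at x)" for b
    by (rule smooth_on_has_derivative[OF smooth_on_directional_derivative[OF g(1)] g(2,3)])
  have "((\<lambda>y. \<Sum>b\<in>Basis. (Y y \<bullet> b) * ?D y b) has_derivative
      (\<lambda>w. \<Sum>b\<in>Basis. (Y x \<bullet> b) * ?H b w + (?DY w \<bullet> b) * ?D x b)) (at x within N)"
    by (intro has_derivative_sum has_derivative_mult[OF has_derivative_inner_left[OF DY]]
        has_derivative_at_withinI[OF H])
  then have "(deriv_along N Y f has_derivative
      (\<lambda>w. \<Sum>b\<in>Basis. (Y x \<bullet> b) * ?H b w + (?DY w \<bullet> b) * ?D x b)) (at x within N)"
  proof (rule has_derivative_transform_locally[OF _ g(2,3) \<open>x \<in> N\<close>])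
    fix y assume that: "y \<in> U" "y \<in> N"
    show "(\<Sum>b\<in>Basis. (Y y \<bullet> b) * ?D y b) = deriv_along N Y f y"
      using frechet_derivative_within_eq_extension[OF g(1,2) that(1) gf that(2) tY[OF that(2)]]
        linear_basis_expansion[OF lin[OF that(1)], of "Y y"]
      by (simp add: deriv_along_def)
  qed
  from deriv_along_has_derivative[where X = X, OF this] tX
  have "deriv_along N X (deriv_along N Y f) x
    = (\<Sum>b\<in>Basis. (Y x \<bullet> b) * ?H b (X x)) + (\<Sum>b\<in>Basis. (deriv_along N X Y x \<bullet> b) * ?D x b)"
    by (simp add: deriv_along_def sum.distrib)
  moreover have "(\<Sum>b\<in>Basis. (deriv_along N X Y x \<bullet> b) * ?D x b) = ?D x (deriv_along N X Y x)"
    using linear_basis_expansion[OF lin[OF g(3)], of "deriv_along N X Y x"] by simp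
  moreover have "(\<Sum>b\<in>Basis. (Y x \<bullet> b) * ?H b (X x)) = ?H (X x) (Y x)"
  proof -
    have "linear (?H (X x))"
      by (rule has_derivative_linear[OF H])
    moreover have "?H b (X x) = ?H (X x) b" for b
      by (rule second_derivative_symmetric[OF g])
    ultimately show ?thesis
      using linear_basis_expansion[of "?H (X x)" "Y x"] by (simp only: real_scaleR_def)
  qed
  ultimately show ?thesis by simp
qed

section \<open>The pseudo-Euclidean scalar product\<close>

definition psign :: "nat \<Rightarrow> 'm :: {finite,linorder} \<Rightarrow> real" where
  "psign u i = (if card {..<i} < CARD('m) - u then 1 else - 1)"

lemma psign_square [simp]: "psign u i * psign u i = 1"
  by (simp add: psign_def)

lemma pinner_psign: "pinner u x y = (\<Sum>i\<in>UNIV. psign u i * x $ i * y $ i)"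
proof -
  have "(\<Sum>i\<in>UNIV. psign u i * x $ i * y $ i) =
    (\<Sum>i\<in>UNIV. if card {..<i} < CARD('a) - u then x $ i * y $ i else - (x $ i * y $ i))"
    by (rule sum.cong) (auto simp: psign_def)
  also have "\<dots> = pinner u x y"
    unfolding pinner_def by (subst sum.If_cases) (simp_all add: sum_negf Collect_neg_eq)
  finally show ?thesis ..
qed

definition flip_signs :: "nat \<Rightarrow> 'm rvec \<Rightarrow> ('m :: {finite,linorder}) rvec" where
  "flip_signs u x = (\<chi> i. psign u i * x $ i)"

lemma pinner_inner: "pinner u x y = flip_signs u x \<bullet> y"
  by (simp add: pinner_psign flip_signs_def inner_vec_def)

lemma flip_signs_flip_signs: "flip_signs u (flip_signs u x) = x"
  by (simp add: flip_signs_def vec_eq_iff mult.assoc[symmetric])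

lemma bounded_linear_flip_signs: "bounded_linear (flip_signs u)"
  unfolding linear_conv_bounded_linear[symmetric]
  by (rule linearI) (simp_all add: flip_signs_def vec_eq_iff algebra_simps)

lemma bounded_bilinear_pinner: "bounded_bilinear (pinner u)"
  using bounded_bilinear.comp1[OF bounded_bilinear_inner bounded_linear_flip_signs]
  by (simp add: pinner_inner[abs_def])

lemma pinner_commute: "pinner u x y = pinner u y x"
  by (simp add: pinner_psign mult_ac)

lemmas pinner_simps =
  bounded_bilinear.add_left[OF bounded_bilinear_pinner]
  bounded_bilinear.add_right[OF bounded_bilinear_pinner]
  bounded_bilinear.diff_left[OF bounded_bilinear_pinner]
  bounded_bilinear.diff_right[OF bounded_bilinear_pinner]
  bounded_bilinear.minus_left[OF bounded_bilinear_pinner]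
  bounded_bilinear.minus_right[OF bounded_bilinear_pinner]
  bounded_bilinear.scaleR_left[OF bounded_bilinear_pinner]
  bounded_bilinear.scaleR_right[OF bounded_bilinear_pinner]
  bounded_bilinear.zero_left[OF bounded_bilinear_pinner]
  bounded_bilinear.zero_right[OF bounded_bilinear_pinner]

lemmas bounded_linear_pinner_left = bounded_bilinear.bounded_linear_left[OF bounded_bilinear_pinner]

lemma pinner_nondegenerate:
  assumes "\<And>z. pinner u w z = 0"
  shows "w = 0"
proof -
  have "flip_signs u w = 0"
    using assms[of "flip_signs u w"] by (simp add: pinner_inner)
  then show ?thesis
    using flip_signs_flip_signs[of u w] linear_0[OF bounded_linear.linear[OF bounded_linear_flip_signs]]
    by metis
qed

lemma pinner_axis: "pinner u x (axis i 1) = psign u i * x $ i"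
  by (simp add: pinner_inner inner_axis flip_signs_def)

section \<open>The Levi-Civita connection of a hyperquadric\<close>

text \<open>The pseudo-sphere and the pseudo-hyperbolic space are treated together as the level sets of the
  quadratic form at \<open>\<kappa> = 1\<close> and \<open>\<kappa> = - 1\<close>. The open set \<open>U\<close> cuts out a piece, as needed
  for orthonormal frames, which need not exist globally.\<close>

locale hyperquadric_patch =
  fixes u :: nat and \<kappa> :: real and U :: "('m :: {finite,linorder}) rvec set"
  assumes kappa: "\<kappa> = 1 \<or> \<kappa> = - 1" and open_U: "open U"
begin

definition N :: "'m rvec set" where
  "N = {x. pinner u x x = \<kappa>} \<inter> U"

lemma kappa_square [simp]: "\<kappa> * \<kappa> = 1" "\<kappa> * (\<kappa> * r) = r"
  using kappa by auto

lemma pinner_self: "x \<in> N \<Longrightarrow> pinner u x x = \<kappa>"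
  by (simp add: N_def)

text \<open>Differentiating \<open>\<langle>\<gamma>, \<gamma>\<rangle> = \<kappa>\<close> shows that tangent vectors are orthogonal to \<open>x\<close>. Conversely, the
  line in direction \<open>w\<close> is rescaled back to the hyperquadric; orthogonality of \<open>w\<close> and \<open>x\<close> makes the
  rescaling stationary at \<open>x\<close>.\<close>

lemma tangent_space_N:
  assumes "x \<in> N"
  shows "tangent_space N x = {w. pinner u w x = 0}"
proof (intro equalityI subsetI CollectI)
  fix w assume "w \<in> tangent_space N x"
  then obtain \<gamma> :: "real \<Rightarrow> 'm rvec" where
    \<gamma>: "\<And>t. \<gamma> t \<in> N" "\<gamma> 0 = x" "(\<gamma> has_vector_derivative w) (at 0)"
    unfolding tangent_space_def by blast
  have d: "(\<gamma> has_derivative (\<lambda>h. h *\<^sub>R w)) (at 0)"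
    using \<gamma>(3) by (simp add: has_vector_derivative_def)
  have "((\<lambda>t. pinner u (\<gamma> t) (\<gamma> t)) has_derivative
      (\<lambda>h. pinner u (\<gamma> 0) (h *\<^sub>R w) + pinner u (h *\<^sub>R w) (\<gamma> 0))) (at 0)"
    by (rule bounded_bilinear.FDERIV[OF bounded_bilinear_pinner d d])
  moreover have "((\<lambda>t. pinner u (\<gamma> t) (\<gamma> t)) has_derivative (\<lambda>h. 0)) (at 0)"
    by (simp add: pinner_self[OF \<gamma>(1)])
  ultimately have "(\<lambda>h. pinner u (\<gamma> 0) (h *\<^sub>R w) + pinner u (h *\<^sub>R w) (\<gamma> 0)) = (\<lambda>h. 0)"
    by (rule has_derivative_unique)
  from fun_cong[OF this, of 1] show "pinner u w x = 0"
    by (simp add: \<gamma>(2) pinner_commute[of u x w])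
next
  fix w assume "w \<in> {w. pinner u w x = 0}"
  then have w: "pinner u w x = 0" "pinner u x w = 0" by (simp_all add: pinner_commute[of u x w])
  define c where "c = \<kappa> * pinner u w w"
  \<comment> \<open>The normalized straight line through \<open>x\<close>. It lies in \<open>N\<close> only for small \<open>t\<close>, so it is cut off
    to a curve \<open>\<delta>\<close> that is constant elsewhere.\<close>
  define \<gamma> where "\<gamma> t = (1 / sqrt (1 + c * t\<^sup>2)) *\<^sub>R (x + t *\<^sub>R w)" for t
  define \<delta> where "\<delta> t = (if \<gamma> t \<in> N then \<gamma> t else x)" for t
  have d: "(\<gamma> has_vector_derivative w) (at 0)"
  proof -
    have "((\<lambda>t. 1 / sqrt (1 + c * t\<^sup>2)) has_real_derivative 0) (at 0)"
      by (auto intro!: derivative_eq_intros)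
    moreover have "((\<lambda>t. x + t *\<^sub>R w) has_vector_derivative w) (at 0)"
      by (auto intro!: derivative_eq_intros)
    ultimately have "(\<gamma> has_vector_derivative
        ((1 / sqrt (1 + c * 0\<^sup>2)) *\<^sub>R w + 0 *\<^sub>R (x + 0 *\<^sub>R w))) (at 0)"
      unfolding \<gamma>_def by (rule has_vector_derivative_scaleR)
    then show ?thesis by simp
  qed
  have \<gamma>0: "\<gamma> 0 = x" by (simp add: \<gamma>_def)
  have "\<forall>\<^sub>F t in at 0. \<gamma> t \<in> U"
  proof -
    have "(\<gamma> \<longlongrightarrow> x) (at 0)"
      using has_vector_derivative_continuous[OF d] \<gamma>0 by (simp add: isCont_def)
    moreover have "x \<in> U" using assms by (simp add: N_def)
    ultimately show ?thesis
      by (rule topological_tendstoD[OF _ open_U])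
  qed
  moreover have "\<forall>\<^sub>F t in at 0. 0 < 1 + c * t\<^sup>2"
  proof -
    have "((\<lambda>t. 1 + c * t\<^sup>2) \<longlongrightarrow> 1 + c * 0\<^sup>2) (at 0)"
      by (intro tendsto_intros)
    then show ?thesis
      by (rule order_tendstoD) simp
  qed
  ultimately have ev: "\<forall>\<^sub>F t in at 0. \<gamma> t = \<delta> t"
  proof eventually_elim
    case (elim t)
    have "pinner u (\<gamma> t) (\<gamma> t) = (1 / sqrt (1 + c * t\<^sup>2))\<^sup>2 * (\<kappa> * (1 + c * t\<^sup>2))"
      by (simp add: \<gamma>_def pinner_simps w pinner_self[OF assms] c_def power2_eq_square algebra_simps
          add_divide_distrib)
    also have "\<dots> = \<kappa>"
      using elim(2) by (simp add: power_divide)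
    finally show ?case
      using elim(1) by (simp add: \<delta>_def N_def)
  qed
  have "(\<delta> has_vector_derivative w) (at 0)"
    unfolding has_vector_derivative_def
  proof (rule has_derivative_transform_eventually[where f = \<gamma>])
    show "(\<gamma> has_derivative (\<lambda>h. h *\<^sub>R w)) (at 0)"
      using d by (simp add: has_vector_derivative_def)
    show "\<forall>\<^sub>F t in at 0. \<gamma> t = \<delta> t" by (rule ev)
  qed (use assms \<gamma>0 in \<open>simp_all add: \<delta>_def\<close>)
  moreover have "\<delta> t \<in> N" for t
    using assms by (simp add: \<delta>_def)
  moreover have "\<delta> 0 = x"
    using \<gamma>0 by (simp add: \<delta>_def)
  ultimately show "w \<in> tangent_space N x"
    unfolding tangent_space_def by (intro CollectI exI[of _ \<delta>]) simp
qed

lemma vector_fields_N: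
  "X \<in> vector_fields N \<longleftrightarrow> smooth_on_submanifold N X \<and> (\<forall>x\<in>N. pinner u (X x) x = 0)"
  by (simp add: vector_fields_def tangent_space_N)

lemma vector_field_smooth: "X \<in> vector_fields N \<Longrightarrow> smooth_on_submanifold N X"
  by (simp add: vector_fields_def)

lemma vector_field_tangent: "X \<in> vector_fields N \<Longrightarrow> x \<in> N \<Longrightarrow> X x \<in> tangent_space N x"
  by (simp add: vector_fields_def)

lemma vector_field_orthogonal:
  assumes "X \<in> vector_fields N" "x \<in> N"
  shows "pinner u (X x) x = 0" "pinner u x (X x) = 0"
  using assms by (simp_all add: vector_fields_N pinner_commute[of u x])

lemma smooth_position: "smooth_on_submanifold N (\<lambda>x. x)"
  by (rule smooth_on_submanifold_bounded_linear[OF bounded_linear_ident])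

lemma smooth_pinner:
  "smooth_on_submanifold N f \<Longrightarrow> smooth_on_submanifold N g
    \<Longrightarrow> smooth_on_submanifold N (\<lambda>x. pinner u (f x) (g x))"
  by (rule smooth_on_submanifold_bilinear[OF bounded_bilinear_pinner])

lemma smooth_scaleR:
  fixes f :: "'m rvec \<Rightarrow> real"
  shows "smooth_on_submanifold N f \<Longrightarrow> smooth_on_submanifold N X
    \<Longrightarrow> smooth_on_submanifold N (\<lambda>x. f x *\<^sub>R X x)"
  by (rule smooth_on_submanifold_bilinear[OF bounded_bilinear_scaleR])

lemma smooth_mult:
  fixes f g :: "'m rvec \<Rightarrow> real"
  shows "smooth_on_submanifold N f \<Longrightarrow> smooth_on_submanifold N g
    \<Longrightarrow> smooth_on_submanifold N (\<lambda>x. f x * g x)"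
  by (rule smooth_on_submanifold_bilinear[OF bounded_bilinear_mult])

lemma deriv_along_pinner:
  assumes "X \<in> vector_fields N" "smooth_on_submanifold N f" "smooth_on_submanifold N g" "x \<in> N"
  shows "deriv_along N X (\<lambda>y. pinner u (f y) (g y)) x
    = pinner u (f x) (deriv_along N X g x) + pinner u (deriv_along N X f x) (g x)"
  by (rule deriv_along_bilinear[where X = X, OF bounded_bilinear_pinner assms(2,3,4) vector_field_tangent[OF assms(1,4)]])

lemma deriv_along_scaleR:
  fixes f :: "'m rvec \<Rightarrow> real"
  assumes "X \<in> vector_fields N" "smooth_on_submanifold N f" "smooth_on_submanifold N Y" "x \<in> N"
  shows "deriv_along N X (\<lambda>y. f y *\<^sub>R Y y) x = f x *\<^sub>R deriv_along N X Y x + deriv_along N X f x *\<^sub>R Y x"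
  by (rule deriv_along_bilinear[where X = X, OF bounded_bilinear_scaleR assms(2,3,4) vector_field_tangent[OF assms(1,4)]])

lemma deriv_along_position:
  assumes "X \<in> vector_fields N" "x \<in> N"
  shows "deriv_along N X (\<lambda>y. y) x = X x"
  by (rule deriv_along_bounded_linear[where X = X, OF bounded_linear_ident vector_field_tangent[OF assms]])

lemma deriv_along_pinner_const:
  assumes "X \<in> vector_fields N" "smooth_on_submanifold N Y" "x \<in> N"
  shows "deriv_along N X (\<lambda>y. pinner u (Y y) c) x = pinner u (deriv_along N X Y x) c"
  using deriv_along_pinner[OF assms(1,2) smooth_on_submanifold_const assms(3)]
    deriv_along_const[where X = X and c = c, OF vector_field_tangent[OF assms(1,3)]]
  by (simp add: pinner_simps)

text \<open>The Gauss formula: the tangential part of the derivative in the ambient space.\<close>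

definition connection :: "('m rvec \<Rightarrow> 'm rvec) \<Rightarrow> ('m rvec \<Rightarrow> 'm rvec) \<Rightarrow> 'm rvec \<Rightarrow> 'm rvec" where
  "connection X Y x = deriv_along N X Y x + (\<kappa> * pinner u (X x) (Y x)) *\<^sub>R x"

text \<open>This is the derivative along \<open>X\<close> of the constant function \<open>\<langle>Y, x\<rangle> = 0\<close>.\<close>

lemma normal_part_deriv_along:
  assumes "X \<in> vector_fields N" "Y \<in> vector_fields N" "x \<in> N"
  shows "pinner u (deriv_along N X Y x) x = - pinner u (X x) (Y x)"
proof -
  have "0 = deriv_along N X (\<lambda>y. 0 :: real) x"
    using deriv_along_const[where X = X, OF vector_field_tangent[OF assms(1,3)]] by simp
  also have "\<dots> = deriv_along N X (\<lambda>y. pinner u (Y y) y) x"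
    by (rule deriv_along_cong[OF assms(3)]) (simp add: vector_field_orthogonal[OF assms(2)])
  also have "\<dots> = pinner u (Y x) (X x) + pinner u (deriv_along N X Y x) x"
    using deriv_along_pinner[OF assms(1) vector_field_smooth[OF assms(2)] smooth_position assms(3)]
      deriv_along_position[OF assms(1,3)] by simp
  finally show ?thesis by (simp add: pinner_commute[of u "X x"])
qed

lemma connection_orthogonal:
  assumes "X \<in> vector_fields N" "Y \<in> vector_fields N" "x \<in> N"
  shows "pinner u (connection X Y x) x = 0"
  using normal_part_deriv_along[OF assms] pinner_self[OF assms(3)]
  by (simp add: connection_def pinner_simps mult.assoc mult.left_commute)

lemma connection_vector_field:
  assumes "X \<in> vector_fields N" "Y \<in> vector_fields N"
  shows "connection X Y \<in> vector_fields N"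
proof -
  note S = vector_field_smooth[OF assms(1)] vector_field_smooth[OF assms(2)]
  have "smooth_on_submanifold N (\<lambda>x. deriv_along N X Y x + (\<kappa> * pinner u (X x) (Y x)) *\<^sub>R x)"
    by (intro smooth_on_submanifold_add smooth_scaleR smooth_mult smooth_position smooth_pinner
        deriv_along_smooth[OF assms(1)] S smooth_on_submanifold_const)
  then have "smooth_on_submanifold N (connection X Y)"
    by (simp add: connection_def[abs_def])
  then show ?thesis
    by (simp add: vector_fields_N connection_orthogonal[OF assms])
qed

definition tangent_part :: "'m rvec \<Rightarrow> 'm rvec \<Rightarrow> 'm rvec" where
  "tangent_part c x = c - (\<kappa> * pinner u c x) *\<^sub>R x"

lemma tangent_part_vector_field: "tangent_part c \<in> vector_fields N"
proof -
  have "smooth_on_submanifold N (\<lambda>x. c + (- \<kappa> * pinner u c x) *\<^sub>R x)"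
    by (intro smooth_on_submanifold_add smooth_scaleR smooth_mult smooth_position smooth_pinner
        smooth_on_submanifold_const)
  then have "smooth_on_submanifold N (tangent_part c)"
    by (rule smooth_on_submanifold_cong) (simp add: tangent_part_def)
  moreover have "pinner u (tangent_part c x) x = 0" if "x \<in> N" for x
    using pinner_self[OF that] by (simp add: tangent_part_def pinner_simps mult.assoc mult.left_commute)
  ultimately show ?thesis by (simp add: vector_fields_N)
qed

lemma tangent_nondegenerate:
  assumes "x \<in> N" "pinner u w x = 0" "\<And>z. pinner u z x = 0 \<Longrightarrow> pinner u w z = 0"
  shows "w = 0"
proof (rule pinner_nondegenerate[of u])
  fix c
  have "pinner u w (tangent_part c x) = 0"
    by (intro assms(3) vector_field_orthogonal(1)[OF tangent_part_vector_field assms(1)])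
  then show "pinner u w c = 0"
    by (simp add: tangent_part_def pinner_simps assms(2))
qed

text \<open>Testing the torsion condition on linear functions alone already shows that the difference \<open>S\<close> of
  the two connections is symmetric; compatibility with the metric makes it skew.\<close>

theorem levi_civita_unique:
  assumes "levi_civita u N nabla" and X: "X \<in> vector_fields N" and Y: "Y \<in> vector_fields N"
    and x: "x \<in> N"
  shows "nabla X Y x = connection X Y x"
proof -
  define S where "S X Y = nabla X Y x - connection X Y x" for X Y
  note LC = assms(1)[unfolded levi_civita_def]
  have vf: "nabla X Y \<in> vector_fields N" if "X \<in> vector_fields N" "Y \<in> vector_fields N" for X Y
    using LC that by blast
  have metric: "deriv_along N X (\<lambda>y. pinner u (Y y) (Z y)) x
      = pinner u (nabla X Y x) (Z x) + pinner u (Y x) (nabla X Z x)"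
    if "X \<in> vector_fields N" "Y \<in> vector_fields N" "Z \<in> vector_fields N" for X Y Z
    using conjunct1[OF conjunct2[OF LC]] that x by simp
  have torsion: "deriv_along N (nabla X Y) f x - deriv_along N (nabla Y X) f x
      = deriv_along N X (deriv_along N Y f) x - deriv_along N Y (deriv_along N X f) x"
    if "X \<in> vector_fields N" "Y \<in> vector_fields N" "smooth_on_submanifold N f"
    for X Y and f :: "'m rvec \<Rightarrow> real"
    using conjunct2[OF conjunct2[OF LC]] that x by simp
  have sym: "S X Y = S Y X" if XY: "X \<in> vector_fields N" "Y \<in> vector_fields N" for X Y
  proof -
    have second: "deriv_along N X (deriv_along N Y (\<lambda>y. pinner u y c)) x
        = pinner u (deriv_along N X Y x) c"
      if XY: "X \<in> vector_fields N" "Y \<in> vector_fields N" for X Y c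
    proof -
      have "deriv_along N X (deriv_along N Y (\<lambda>y. pinner u y c)) x
        = deriv_along N X (\<lambda>y. pinner u (Y y) c) x"
        by (rule deriv_along_cong[OF x])
          (rule deriv_along_bounded_linear[where X = Y, OF bounded_linear_pinner_left vector_field_tangent[OF XY(2)]])
      then show ?thesis
        using deriv_along_pinner_const[OF XY(1) vector_field_smooth[OF XY(2)] x] by simp
    qed
    have "pinner u (nabla X Y x - nabla Y X x - (deriv_along N X Y x - deriv_along N Y X x)) c = 0" for c
    proof -
      have "smooth_on_submanifold N (\<lambda>y. pinner u y c)"
        by (rule smooth_on_submanifold_bounded_linear[OF bounded_linear_pinner_left])
      from torsion[OF XY this] second[OF XY] second[OF XY(2,1)]
        deriv_along_bounded_linear[where X = "nabla X Y", OF bounded_linear_pinner_left vector_field_tangent[OF vf[OF XY] x]]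
        deriv_along_bounded_linear[where X = "nabla Y X", OF bounded_linear_pinner_left vector_field_tangent[OF vf[OF XY(2,1)] x]]
      show ?thesis by (simp add: pinner_simps)
    qed
    then have "nabla X Y x - nabla Y X x - (deriv_along N X Y x - deriv_along N Y X x) = 0"
      by (rule pinner_nondegenerate)
    then show ?thesis
      by (simp add: S_def connection_def pinner_commute[of u "Y x"] algebra_simps)
  qed
  have skew: "pinner u (S X Y) (Z x) = - pinner u (S X Z) (Y x)"
    if "X \<in> vector_fields N" "Y \<in> vector_fields N" "Z \<in> vector_fields N" for X Y Z
    using metric[OF that] deriv_along_pinner[OF that(1) vector_field_smooth[OF that(2)]
        vector_field_smooth[OF that(3)] x]
      vector_field_orthogonal[OF that(3) x] vector_field_orthogonal[OF that(2) x]
    by (simp add: S_def connection_def pinner_simps pinner_commute[of u "Y x"])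
  \<comment> \<open>A trilinear form that is symmetric in the first two and skew in the last two arguments
    vanishes.\<close>
  have "pinner u (S X Y) (Z x) = 0" if Z: "Z \<in> vector_fields N" for Z
    using skew[OF X Y Z] skew[OF Y Z X] skew[OF Z X Y] sym[OF X Y] sym[OF Y Z] sym[OF Z X] by simp
  then have "pinner u (S X Y) (tangent_part c x) = 0" for c
    using tangent_part_vector_field by blast
  moreover have S0: "pinner u (S X Y) x = 0"
    using vector_field_orthogonal[OF vf[OF X Y] x] connection_orthogonal[OF X Y x]
    by (simp add: S_def pinner_simps)
  ultimately have "pinner u (S X Y) c = 0" for c
    by (simp add: tangent_part_def pinner_simps)
  then have "S X Y = 0" by (rule pinner_nondegenerate)
  then show ?thesis by (simp add: S_def)
qed

text \<open>Linearity and the product rules are inherited from the ambient derivative. The torsion vanishes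
  because the Hessian terms of the two iterated derivatives cancel.\<close>

theorem levi_civita_exists: "levi_civita u N connection"
  unfolding levi_civita_def
proof (intro conjI ballI allI impI)
  fix X Y assume X: "X \<in> vector_fields N" and Y: "Y \<in> vector_fields N"
  show "connection X Y \<in> vector_fields N"
    by (rule connection_vector_field[OF X Y])
  fix x assume x: "x \<in> N"
  note sX = vector_field_smooth[OF X] and sY = vector_field_smooth[OF Y]
  note lin = linear_frechet_derivative_within[OF _ x]
  {
    fix Z assume Z: "Z \<in> vector_fields N"
    note sZ = vector_field_smooth[OF Z]
    show "connection (\<lambda>y. X y + Y y) Z x = connection X Z x + connection Y Z x"
      by (simp add: connection_def deriv_along_def linear_add[OF lin[OF sZ]] pinner_simps algebra_simps)
    show "connection X (\<lambda>y. Y y + Z y) x = connection X Y x + connection X Z x"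
      using deriv_along_add[where X = X, OF sY sZ x vector_field_tangent[OF X x]]
      by (simp add: connection_def pinner_simps algebra_simps)
    show "deriv_along N X (\<lambda>y. pinner u (Y y) (Z y)) x
      = pinner u (connection X Y x) (Z x) + pinner u (Y x) (connection X Z x)"
      using deriv_along_pinner[OF X sY sZ x]
        vector_field_orthogonal[OF Y x] vector_field_orthogonal[OF Z x]
      by (simp add: connection_def pinner_simps)
  }
  fix f :: "'m rvec \<Rightarrow> real" assume f: "smooth_on_submanifold N f"
  show "connection (\<lambda>y. f y *\<^sub>R X y) Y x = f x *\<^sub>R connection X Y x"
    by (simp add: connection_def deriv_along_def linear_cmul[OF lin[OF sY]] pinner_simps algebra_simps)
  show "connection X (\<lambda>y. f y *\<^sub>R Y y) x = deriv_along N X f x *\<^sub>R Y x + f x *\<^sub>R connection X Y x"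
    using deriv_along_scaleR[OF X f sY x]
    by (simp add: connection_def pinner_simps algebra_simps)
  let ?B = "deriv_along N X Y x - deriv_along N Y X x"
  obtain V g where g: "open V" "x \<in> V" "smooth_on V g" "\<forall>y \<in> V \<inter> N. g y = f y"
    by (rule smooth_on_submanifoldE[OF f x]) (rule that)
  have "?B \<in> tangent_space N x"
    using normal_part_deriv_along[OF X Y x] normal_part_deriv_along[OF Y X x]
    by (simp add: tangent_space_N[OF x] pinner_simps pinner_commute[of u "Y x"])
  have "deriv_along N (connection X Y) f x - deriv_along N (connection Y X) f x
    = frechet_derivative f (at x within N) (connection X Y x - connection Y X x)"
    by (simp add: deriv_along_def linear_diff[OF lin[OF f]])
  also have "connection X Y x - connection Y X x = ?B"
    by (simp add: connection_def pinner_commute[of u "Y x"])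
  also have "frechet_derivative f (at x within N) ?B = frechet_derivative g (at x) ?B"
    by (rule frechet_derivative_within_eq_extension[OF g(3,1,2,4) x \<open>?B \<in> tangent_space N x\<close>])
  also have "\<dots> = frechet_derivative g (at x) (deriv_along N X Y x)
      - frechet_derivative g (at x) (deriv_along N Y X x)"
    by (rule linear_diff[OF has_derivative_linear[OF smooth_on_has_derivative[OF g(3,1,2)]]])
  also have "\<dots> = deriv_along N X (deriv_along N Y f) x - deriv_along N Y (deriv_along N X f) x"
    using second_deriv_along[OF X Y x g(3,1,2,4)] second_deriv_along[OF Y X x g(3,1,2,4)]
      second_derivative_symmetric[OF g(3,1,2), where v = "X x" and w = "Y x"] by simp
  finally show "deriv_along N (connection X Y) f x - deriv_along N (connection Y X) f x
    = deriv_along N X (deriv_along N Y f) x - deriv_along N Y (deriv_along N X f) x" .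
qed

end

section \<open>The tension field of a conformal gradient field\<close>

context hyperquadric_patch
begin

lemma pinner_tangent_part:
  assumes "pinner u z x = 0"
  shows "pinner u (tangent_part a x) z = pinner u a z" "pinner u z (tangent_part a x) = pinner u z a"
  using assms by (simp_all add: tangent_part_def pinner_simps pinner_commute[of u x z])

lemma pinner_tangent_part_self:
  assumes "x \<in> N"
  shows "pinner u (tangent_part a x) (tangent_part a x) = pinner u a a - \<kappa> * (pinner u a x)\<^sup>2"
  using pinner_self[OF assms]
  by (simp add: tangent_part_def pinner_simps pinner_commute[of u x a] algebra_simps power2_eq_square)

lemma grad_eqI:
  assumes x: "x \<in> N" and f: "(f has_derivative f') (at x within N)"
    and w: "pinner u w x = 0" and wf: "\<And>z. pinner u z x = 0 \<Longrightarrow> pinner u w z = f' z"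
  shows "grad u N f x = w"
proof -
  have f'_eq: "frechet_derivative f (at x within N) z = f' z" if "pinner u z x = 0" for z
    using frechet_derivative_within_tangent[OF f] that by (simp add: tangent_space_N[OF x])
  show ?thesis
    unfolding grad_def tangent_space_N[OF x]
  proof (rule the_equality)
    show "w \<in> {w. pinner u w x = 0} \<and> (\<forall>z\<in>{w. pinner u w x = 0}.
        pinner u w z = frechet_derivative f (at x within N) z)"
      using w wf f'_eq by simp
    fix w' assume w': "w' \<in> {w. pinner u w x = 0} \<and> (\<forall>z\<in>{w. pinner u w x = 0}.
        pinner u w' z = frechet_derivative f (at x within N) z)"
    have "w' - w = 0"
      by (rule tangent_nondegenerate[OF x]) (use w w' wf f'_eq in \<open>simp_all add: pinner_simps\<close>)
    then show "w' = w" by simp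
  qed
qed

lemma conformal_gradient_field_eq:
  assumes "x \<in> N"
  shows "conformal_gradient_field u N a x = tangent_part a x"
  unfolding conformal_gradient_field_def
proof (rule grad_eqI[OF assms])
  show "((\<lambda>x. pinner u x a) has_derivative (\<lambda>x. pinner u x a)) (at x within N)"
    by (rule bounded_linear_imp_has_derivative[OF bounded_linear_pinner_left])
  show "pinner u (tangent_part a x) x = 0"
    by (rule vector_field_orthogonal(1)[OF tangent_part_vector_field assms])
qed (simp add: pinner_tangent_part pinner_commute[of u a])

lemma connection_cong:
  assumes "x \<in> N" "\<And>y. y \<in> N \<Longrightarrow> Y y = Z y"
  shows "connection X Y x = connection X Z x"
  using deriv_along_cong[OF assms] assms by (simp add: connection_def)

lemma connection_scaleR:
  fixes f :: "'m rvec \<Rightarrow> real"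
  assumes "X \<in> vector_fields N" "Y \<in> vector_fields N" "smooth_on_submanifold N f" "x \<in> N"
  shows "connection X (\<lambda>y. f y *\<^sub>R Y y) x = deriv_along N X f x *\<^sub>R Y x + f x *\<^sub>R connection X Y x"
  using conjunct2[OF conjunct2[OF levi_civita_exists[unfolded levi_civita_def]]] assms by simp

lemma has_derivative_pinner_right: "(pinner u a has_derivative pinner u a) F"
  by (rule bounded_linear_imp_has_derivative)
    (rule bounded_bilinear.bounded_linear_right[OF bounded_bilinear_pinner])

lemma smooth_alpha: "smooth_on_submanifold N (\<lambda>y. - \<kappa> * pinner u a y)"
  by (intro smooth_mult smooth_pinner smooth_position smooth_on_submanifold_const)

lemma deriv_along_alpha:
  assumes "X \<in> vector_fields N" "x \<in> N"
  shows "deriv_along N X (\<lambda>y. - \<kappa> * pinner u a y) x = - \<kappa> * pinner u a (X x)"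
  by (rule deriv_along_has_derivative[where X = X, OF _ vector_field_tangent[OF assms]])
    (rule has_derivative_mult_right[OF has_derivative_pinner_right])

text \<open>The covariant derivative of a conformal gradient field is a multiple of the identity. This is
  what makes its tension field computable.\<close>

lemma connection_tangent_part:
  assumes "X \<in> vector_fields N" "x \<in> N"
  shows "connection X (tangent_part a) x = (- \<kappa> * pinner u a x) *\<^sub>R X x"
proof -
  have "deriv_along N X (tangent_part a) x
      = deriv_along N X (\<lambda>y. a + (- \<kappa> * pinner u a y) *\<^sub>R y) x"
    by (rule deriv_along_cong[OF assms(2)]) (simp add: tangent_part_def)
  also have "\<dots> = deriv_along N X (\<lambda>y. a) x + deriv_along N X (\<lambda>y. (- \<kappa> * pinner u a y) *\<^sub>R y) x"
    by (intro deriv_along_add[where X = X] smooth_on_submanifold_const smooth_scaleR smooth_alpha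
        smooth_position vector_field_tangent assms)
  also have "\<dots> = (- \<kappa> * pinner u a x) *\<^sub>R X x + (- \<kappa> * pinner u a (X x)) *\<^sub>R x"
    using deriv_along_scaleR[OF assms(1) smooth_alpha smooth_position assms(2)]
      deriv_along_alpha[OF assms] deriv_along_position[OF assms]
      deriv_along_const[where X = X and c = a, OF vector_field_tangent[OF assms]]
    by simp
  finally show ?thesis
    using vector_field_orthogonal[OF assms]
    by (simp add: connection_def pinner_tangent_part pinner_commute[of u "X x" a])
qed

lemma frame_expansion:
  assumes "orthonormal_frame u N d E \<epsilon>" "x \<in> N" "pinner u w x = 0"
  shows "w = (\<Sum>i<d. (\<epsilon> i * pinner u w (E i x)) *\<^sub>R E i x)"
proof -
  let ?P = "\<lambda>w. \<Sum>i<d. (\<epsilon> i * pinner u w (E i x)) *\<^sub>R E i x"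
  have on: "pinner u (E i x) (E j x) = (if i = j then \<epsilon> i else 0)" if "i < d" "j < d" for i j
    using assms(1,2) that by (simp add: orthonormal_frame_def)
  have eps: "\<epsilon> i * \<epsilon> i = 1" if "i < d" for i
    using assms(1) that by (auto simp: orthonormal_frame_def)
  have "span ((\<lambda>i. E i x) ` {..<d}) \<subseteq> {w. w = ?P w}"
  proof (rule span_minimal)
    show "(\<lambda>i. E i x) ` {..<d} \<subseteq> {w. w = ?P w}"
    proof (intro subsetI CollectI, elim imageE)
      fix w j assume w: "w = E j x" and j: "j \<in> {..<d}"
      have "?P w = (\<Sum>i<d. if i = j then E j x else 0)"
        unfolding w by (rule sum.cong) (use j in \<open>simp_all add: on eps\<close>)
      then show "w = ?P w" using j w by simp
    qed
    show "subspace {w. w = ?P w}"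
    proof (rule subspaceI)
      show "0 \<in> {w. w = ?P w}" by (simp add: pinner_simps)
      show "x + y \<in> {w. w = ?P w}" if "x \<in> {w. w = ?P w}" "y \<in> {w. w = ?P w}" for x y
        using that by (simp add: pinner_simps ring_distribs scaleR_add_left sum.distrib)
      show "c *\<^sub>R x \<in> {w. w = ?P w}" if "x \<in> {w. w = ?P w}" for c x
      proof -
        have "?P (c *\<^sub>R x) = c *\<^sub>R ?P x"
          by (simp add: pinner_simps scaleR_right.sum mult_ac)
        then show ?thesis using that by simp
      qed
    qed
  qed
  moreover have "w \<in> span ((\<lambda>i. E i x) ` {..<d})"
    using assms by (simp add: orthonormal_frame_def tangent_space_N)
  ultimately show ?thesis by blast
qed

lemma frame_parseval:
  assumes "orthonormal_frame u N d E \<epsilon>" "x \<in> N" "pinner u w x = 0"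
  shows "pinner u w w = (\<Sum>i<d. \<epsilon> i * (pinner u w (E i x))\<^sup>2)"
proof -
  have "pinner u w w = pinner u w (\<Sum>i<d. (\<epsilon> i * pinner u w (E i x)) *\<^sub>R E i x)"
    using frame_expansion[OF assms] by simp
  also have "\<dots> = (\<Sum>i<d. \<epsilon> i * (pinner u w (E i x))\<^sup>2)"
    by (simp add: bounded_bilinear.sum_right[OF bounded_bilinear_pinner] pinner_simps
        power2_eq_square mult_ac)
  finally show ?thesis .
qed

text \<open>The metric trace of the projection onto the tangent space can be computed in the frame,
  where it is the number of frame vectors, and in the standard basis of the ambient space.\<close>

lemma frame_dimension:
  assumes E: "orthonormal_frame u N d E \<epsilon>" and x: "x \<in> N"
  shows "real d = real CARD('m) - 1"
proof -
  let ?e = "\<lambda>j. axis j (1 :: real)"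
  have eps: "\<epsilon> i * pinner u (E i x) (E i x) = 1" if "i < d" for i
    using E x that by (auto simp: orthonormal_frame_def)
  have vf: "pinner u (E i x) x = 0" if "i < d" for i
    using E vector_field_orthogonal(1)[OF _ x] that by (auto simp: orthonormal_frame_def)
  have self: "pinner u y y = (\<Sum>j\<in>UNIV. psign u j * (pinner u (?e j) y)\<^sup>2)" for y
  proof -
    have "psign u j * y $ j * y $ j = psign u j * (pinner u (?e j) y)\<^sup>2" for j
      by (simp add: pinner_commute[of u "?e j"] pinner_axis power2_eq_square algebra_simps psign_def)
    then show ?thesis by (simp only: pinner_psign[of u y y])
  qed
  have "real d = (\<Sum>i<d. \<epsilon> i * pinner u (E i x) (E i x))"
    by (simp add: eps)
  also have "\<dots> = (\<Sum>i<d. \<epsilon> i * (\<Sum>j\<in>UNIV. psign u j * (pinner u (?e j) (E i x))\<^sup>2))"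
    by (simp only: self[symmetric])
  also have "\<dots> = (\<Sum>i<d. \<Sum>j\<in>UNIV. psign u j * (\<epsilon> i * (pinner u (?e j) (E i x))\<^sup>2))"
    by (simp add: sum_distrib_left mult.left_commute)
  also have "\<dots> = (\<Sum>j\<in>UNIV. psign u j * (\<Sum>i<d. \<epsilon> i * (pinner u (?e j) (E i x))\<^sup>2))"
    by (subst sum.swap) (simp add: sum_distrib_left)
  also have "\<dots> = (\<Sum>j\<in>UNIV. psign u j * pinner u (tangent_part (?e j) x) (tangent_part (?e j) x))"
  proof (rule sum.cong[OF refl])
    fix j
    have "pinner u (tangent_part (?e j) x) (tangent_part (?e j) x)
      = (\<Sum>i<d. \<epsilon> i * (pinner u (tangent_part (?e j) x) (E i x))\<^sup>2)"
      by (rule frame_parseval[OF E x vector_field_orthogonal(1)[OF tangent_part_vector_field x]])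
    also have "\<dots> = (\<Sum>i<d. \<epsilon> i * (pinner u (?e j) (E i x))\<^sup>2)"
      by (rule sum.cong[OF refl]) (simp add: pinner_tangent_part vf)
    finally show "psign u j * (\<Sum>i<d. \<epsilon> i * (pinner u (?e j) (E i x))\<^sup>2)
      = psign u j * pinner u (tangent_part (?e j) x) (tangent_part (?e j) x)" by simp
  qed
  also have "\<dots> = (\<Sum>j\<in>UNIV. 1 - \<kappa> * (psign u j * (pinner u (?e j) x)\<^sup>2))"
    by (rule sum.cong[OF refl])
      (simp add: pinner_tangent_part_self[OF x] pinner_axis right_diff_distrib mult.left_commute)
  also have "\<dots> = real CARD('m) - \<kappa> * (\<Sum>j\<in>UNIV. psign u j * (pinner u (?e j) x)\<^sup>2)"
    by (simp add: sum_subtractf sum_distrib_left)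
  also have "\<dots> = real CARD('m) - 1"
    by (simp only: self[of x, symmetric] pinner_self[OF x] kappa_square)
  finally show ?thesis .
qed

text \<open>With \<open>\<alpha> = \<langle>a, x\<rangle>\<close> one has \<open>2 F = \<mu> - \<kappa> \<alpha>\<^sup>2\<close>, hence \<open>grad F = - \<kappa> \<alpha> \<sigma>\<close>. Differentiating once
  more, and taking traces with the help of the frame expansion, gives the rough Laplacian \<open>\<kappa> \<sigma>\<close>, the
  squared norm \<open>d \<alpha>\<^sup>2\<close> of the covariant derivative, and the Laplacian \<open>\<kappa> \<mu> - (d + 1) \<alpha>\<^sup>2\<close> of \<open>F\<close>.
  All terms of the tension field are thus multiples of \<open>\<sigma>\<close> by polynomials in \<open>\<alpha>\<^sup>2\<close>.\<close>

lemma tension_eq: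
  assumes LC: "levi_civita u N nabla" and E: "orthonormal_frame u N d E \<epsilon>"
    and \<sigma>: "\<And>y. y \<in> N \<Longrightarrow> \<sigma> y = tangent_part a y" and x: "x \<in> N"
  defines "\<mu> \<equiv> pinner u a a" and "\<alpha> \<equiv> pinner u a x"
  shows "tension u N nabla d E \<epsilon> p q \<sigma> x =
    (\<kappa> * ((1 + \<mu>) * (1 + q * \<mu>))
     + (p * (2 - real d) - 1 + p * q * \<mu> - q * (1 + \<mu>) * (real d + 1) - q * \<mu>) * \<alpha>\<^sup>2
     + \<kappa> * (q * (real d + 1 - p)) * \<alpha> ^ 4) *\<^sub>R \<sigma> x"
proof -
  let ?s = "tangent_part a" and ?F = "\<lambda>y. pinner u (\<sigma> y) (\<sigma> y) / 2"
  note nabla = levi_civita_unique[OF LC]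
  have vE: "E i \<in> vector_fields N" if "i < d" for i
    using E that by (simp add: orthonormal_frame_def)
  have EE: "\<epsilon> i * pinner u (E i x) (E i x) = 1" if "i < d" for i
    using E x that by (auto simp: orthonormal_frame_def)
  have vs: "\<sigma> \<in> vector_fields N"
  proof -
    have "smooth_on_submanifold N \<sigma>"
      by (rule smooth_on_submanifold_cong[OF vector_field_smooth[OF tangent_part_vector_field]])
        (simp add: \<sigma>)
    then show ?thesis
      using vector_field_orthogonal(1)[OF tangent_part_vector_field] by (simp add: vector_fields_N \<sigma>)
  qed
  have sx: "\<sigma> x = ?s x" by (rule \<sigma>[OF x])
  have orth: "pinner u (?s x) x = 0"
    by (rule vector_field_orthogonal(1)[OF tangent_part_vector_field x])
  have ss: "pinner u (?s x) (?s x) = \<mu> - \<kappa> * \<alpha>\<^sup>2"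
    by (simp add: pinner_tangent_part_self[OF x] \<mu>_def \<alpha>_def)
  have aE: "pinner u a (E i x) = pinner u (?s x) (E i x)" if "i < d" for i
    using vector_field_orthogonal(1)[OF vE[OF that] x] by (simp add: pinner_tangent_part)
  have nabla_\<sigma>: "nabla X \<sigma> y = (- \<kappa> * pinner u a y) *\<^sub>R X y" if "X \<in> vector_fields N" "y \<in> N" for X y
    using nabla[OF that(1) vs that(2)] connection_cong[OF that(2), of \<sigma> ?s X] \<sigma>
      connection_tangent_part[OF that] by simp
  have gradF: "grad u N ?F y = (- \<kappa> * pinner u a y) *\<^sub>R ?s y" if y: "y \<in> N" for y
  proof (rule grad_eqI[OF y])
    show "(?F has_derivative (\<lambda>w. - \<kappa> * pinner u a y * pinner u a w)) (at y within N)"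
    proof (rule has_derivative_transform[OF y])
      show "((\<lambda>z. (\<mu> - \<kappa> * (pinner u a z)\<^sup>2) / 2) has_derivative
        (\<lambda>w. - \<kappa> * pinner u a y * pinner u a w)) (at y within N)"
        by (auto intro!: derivative_eq_intros has_derivative_pinner_right)
    qed (simp add: \<sigma> pinner_tangent_part_self \<mu>_def)
    show "pinner u ((- \<kappa> * pinner u a y) *\<^sub>R ?s y) y = 0"
      using vector_field_orthogonal(1)[OF tangent_part_vector_field y] by (simp add: pinner_simps)
  qed (simp add: pinner_simps pinner_tangent_part)
  have vgrad: "grad u N ?F \<in> vector_fields N"
  proof -
    have "smooth_on_submanifold N (\<lambda>y. (- \<kappa> * pinner u a y) *\<^sub>R ?s y)"
      by (intro smooth_scaleR smooth_alpha vector_field_smooth tangent_part_vector_field)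
    then have "smooth_on_submanifold N (grad u N ?F)"
      by (rule smooth_on_submanifold_cong) (simp add: gradF)
    then show ?thesis
      using vector_field_orthogonal(1)[OF tangent_part_vector_field]
      by (simp add: vector_fields_N gradF pinner_simps)
  qed
  have nabla_grad: "nabla X (grad u N ?F) x = \<alpha>\<^sup>2 *\<^sub>R X x - (\<kappa> * pinner u a (X x)) *\<^sub>R ?s x"
    if X: "X \<in> vector_fields N" for X
  proof -
    have "nabla X (grad u N ?F) x = connection X (\<lambda>y. (- \<kappa> * pinner u a y) *\<^sub>R ?s y) x"
      using nabla[OF X vgrad x] connection_cong[OF x, of "grad u N ?F" _ X] gradF by simp
    also have "\<dots> = (- \<kappa> * pinner u a (X x)) *\<^sub>R ?s x + (- \<kappa> * pinner u a x) *\<^sub>R ((- \<kappa> * pinner u a x) *\<^sub>R X x)"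
      using connection_scaleR[OF X tangent_part_vector_field smooth_alpha x]
        deriv_along_alpha[OF X x] connection_tangent_part[OF X x] by simp
    finally show ?thesis
      by (simp add: \<alpha>_def power2_eq_square mult.assoc mult.left_commute)
  qed
  have second: "second_cov nabla (E i) (E i) \<sigma> x = - (\<kappa> * pinner u a (E i x)) *\<^sub>R E i x" if "i < d" for i
  proof -
    have "nabla (E i) \<sigma> \<in> vector_fields N" "nabla (E i) (E i) \<in> vector_fields N"
      using LC vE[OF that] vs unfolding levi_civita_def by simp_all
    moreover have "connection (E i) (nabla (E i) \<sigma>) x
        = connection (E i) (\<lambda>y. (- \<kappa> * pinner u a y) *\<^sub>R E i y) x"
      by (rule connection_cong[OF x]) (simp add: nabla_\<sigma> vE[OF that])
    ultimately show ?thesis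
      using connection_scaleR[OF vE[OF that] vE[OF that] smooth_alpha x]
        deriv_along_alpha[OF vE[OF that] x]
      by (simp add: second_cov_def nabla[OF vE[OF that] _ x] nabla_\<sigma>[OF _ x] vE[OF that])
  qed
  have rough: "rough_laplacian nabla d E \<epsilon> \<sigma> x = \<kappa> *\<^sub>R ?s x"
  proof -
    have "rough_laplacian nabla d E \<epsilon> \<sigma> x
      = \<kappa> *\<^sub>R (\<Sum>i<d. (\<epsilon> i * pinner u (?s x) (E i x)) *\<^sub>R E i x)"
      by (simp add: rough_laplacian_def second aE sum_negf scaleR_right.sum mult_ac)
    then show ?thesis using frame_expansion[OF E x orth] by simp
  qed
  have cov: "cov_norm u nabla d E \<epsilon> \<sigma> x = real d * \<alpha>\<^sup>2"
  proof -
    have "\<epsilon> i * pinner u (nabla (E i) \<sigma> x) (nabla (E i) \<sigma> x) = \<alpha>\<^sup>2" if "i < d" for i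
    proof -
      have "\<epsilon> i * pinner u (nabla (E i) \<sigma> x) (nabla (E i) \<sigma> x)
        = (\<kappa> * \<kappa>) * \<alpha>\<^sup>2 * (\<epsilon> i * pinner u (E i x) (E i x))"
        by (simp only: nabla_\<sigma>[OF vE[OF that] x] pinner_simps \<alpha>_def power2_eq_square)
          (simp add: mult_ac)
      then show ?thesis by (simp add: EE[OF that])
    qed
    then show ?thesis by (simp add: cov_norm_def)
  qed
  have lap: "laplacian u N nabla d E \<epsilon> ?F x = \<kappa> * \<mu> - (real d + 1) * \<alpha>\<^sup>2"
  proof -
    have "\<epsilon> i * pinner u (nabla (E i) (grad u N ?F) x) (E i x)
      = \<alpha>\<^sup>2 - \<kappa> * (\<epsilon> i * (pinner u (?s x) (E i x))\<^sup>2)" if "i < d" for i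
    proof -
      have "\<epsilon> i * pinner u (nabla (E i) (grad u N ?F) x) (E i x)
        = \<alpha>\<^sup>2 * (\<epsilon> i * pinner u (E i x) (E i x)) - \<kappa> * (\<epsilon> i * (pinner u (?s x) (E i x))\<^sup>2)"
        by (simp add: nabla_grad[OF vE[OF that]] aE[OF that] pinner_simps power2_eq_square algebra_simps)
      then show ?thesis by (simp add: EE[OF that])
    qed
    then have "laplacian u N nabla d E \<epsilon> ?F x
      = - (real d * \<alpha>\<^sup>2 - \<kappa> * (\<Sum>i<d. \<epsilon> i * (pinner u (?s x) (E i x))\<^sup>2))"
      by (simp add: laplacian_def divergence_def sum_subtractf sum_distrib_left)
    also have "(\<Sum>i<d. \<epsilon> i * (pinner u (?s x) (E i x))\<^sup>2) = \<mu> - \<kappa> * \<alpha>\<^sup>2"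
      using frame_parseval[OF E x orth] ss by simp
    finally show ?thesis by (simp add: algebra_simps)
  qed
  have nabla_gradF_\<sigma>: "nabla (grad u N ?F) \<sigma> x = \<alpha>\<^sup>2 *\<^sub>R ?s x"
    by (simp add: nabla_\<sigma>[OF vgrad x] gradF[OF x] \<alpha>_def power2_eq_square mult.assoc mult.left_commute)
  have grad2: "pinner u (grad u N ?F x) (grad u N ?F x) = \<alpha>\<^sup>2 * (\<mu> - \<kappa> * \<alpha>\<^sup>2)"
    by (simp add: gradF[OF x] pinner_simps ss \<alpha>_def power2_eq_square mult.assoc mult.left_commute)
  have two_F: "1 + 2 * ?F x = 1 + \<mu> - \<kappa> * \<alpha>\<^sup>2"
    by (simp add: sx ss)
  have "tension u N nabla d E \<epsilon> p q \<sigma> x =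
      ((1 + \<mu> - \<kappa> * \<alpha>\<^sup>2) * \<kappa> + 2 * p * \<alpha>\<^sup>2
        - (p * (real d * \<alpha>\<^sup>2) - p * q * (\<alpha>\<^sup>2 * (\<mu> - \<kappa> * \<alpha>\<^sup>2))
           - q * (1 + \<mu> - \<kappa> * \<alpha>\<^sup>2) * (\<kappa> * \<mu> - (real d + 1) * \<alpha>\<^sup>2))) *\<^sub>R ?s x"
    unfolding tension_def Let_def two_F rough nabla_gradF_\<sigma> cov grad2 lap sx
    by (simp only: two_F[unfolded sx] scaleR_scaleR scaleR_add_left[symmetric] scaleR_diff_left[symmetric])
  also have "(1 + \<mu> - \<kappa> * \<alpha>\<^sup>2) * \<kappa> + 2 * p * \<alpha>\<^sup>2
        - (p * (real d * \<alpha>\<^sup>2) - p * q * (\<alpha>\<^sup>2 * (\<mu> - \<kappa> * \<alpha>\<^sup>2))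
           - q * (1 + \<mu> - \<kappa> * \<alpha>\<^sup>2) * (\<kappa> * \<mu> - (real d + 1) * \<alpha>\<^sup>2))
     = \<kappa> * ((1 + \<mu>) * (1 + q * \<mu>))
     + (p * (2 - real d) - 1 + p * q * \<mu> - q * (1 + \<mu>) * (real d + 1) - q * \<mu>) * \<alpha>\<^sup>2
     + \<kappa> * (q * (real d + 1 - p)) * \<alpha> ^ 4"
    using kappa_square(1) by algebra
  finally show ?thesis by (simp only: sx)
qed

end

section \<open>Orthonormal frames obtained from reflections\<close>

definition reflection :: "nat \<Rightarrow> 'm rvec \<Rightarrow> 'm rvec \<Rightarrow> ('m :: {finite,linorder}) rvec" where
  "reflection u b w = w - (2 * pinner u b w / pinner u b b) *\<^sub>R b"

lemma reflection_involutive: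
  assumes "pinner u b b \<noteq> 0"
  shows "reflection u b (reflection u b w) = w"
  using assms by (simp add: reflection_def pinner_simps)

lemma reflection_self_adjoint: "pinner u (reflection u b w) z = pinner u w (reflection u b z)"
  by (simp add: reflection_def pinner_simps pinner_commute[of u w b])

lemma reflection_isometry:
  "pinner u b b \<noteq> 0 \<Longrightarrow> pinner u (reflection u b w) (reflection u b z) = pinner u w z"
  by (simp add: reflection_self_adjoint reflection_involutive)

lemma linear_reflection: "linear (reflection u b)"
  by (rule linearI) (simp_all add: reflection_def pinner_simps algebra_simps add_divide_distrib)

text \<open>Off the hyperplane where \<open>\<langle>x, e\<rangle> = \<langle>e, e\<rangle>\<close>, for a basis vector \<open>e\<close> on the hyperquadric, the
  reflection in \<open>x - e\<close> is an isometry that depends rationally on \<open>x\<close> and takes \<open>e\<close> to \<open>x\<close>. It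
  carries the other basis vectors to an orthonormal frame of the tangent space at \<open>x\<close>. Unlike
  orthonormalization, this needs neither square roots nor a discussion of null vectors.\<close>

locale stereographic_patch =
  fixes u :: nat and i0 :: "'m :: {finite,linorder}"
begin

abbreviation e :: "'m \<Rightarrow> 'm rvec" where
  "e i \<equiv> axis i 1"

definition U0 :: "'m rvec set" where
  "U0 = {x. pinner u x (e i0) \<noteq> psign u i0}"

lemma open_U0: "open U0"
  unfolding U0_def
  by (intro open_Collect_neq continuous_on_const linear_continuous_on bounded_linear_pinner_left)

sublocale hyperquadric_patch u "psign u i0" U0
  by unfold_locales (simp_all add: open_U0, simp add: psign_def)

lemma pinner_basis: "pinner u (e i) (e j) = (if i = j then psign u i else 0)"
  unfolding pinner_axis by (simp add: axis_def)

lemma N_iff: "x \<in> N \<longleftrightarrow> pinner u x x = psign u i0 \<and> pinner u x (e i0) \<noteq> psign u i0"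
  unfolding N_def by (simp add: U0_def)

definition frame :: "'m \<Rightarrow> 'm rvec \<Rightarrow> 'm rvec" where
  "frame i x = reflection u (x - e i0) (e i)"

lemma pinner_axis_vector:
  assumes "x \<in> N"
  shows "pinner u (x - e i0) (x - e i0) = 2 * (psign u i0 - pinner u x (e i0))"
    and "pinner u (x - e i0) (x - e i0) \<noteq> 0"
proof -
  show *: "pinner u (x - e i0) (x - e i0) = 2 * (psign u i0 - pinner u x (e i0))"
    using pinner_self[OF assms]
    by (simp add: pinner_simps pinner_basis pinner_commute[of u "e i0" x])
  show "pinner u (x - e i0) (x - e i0) \<noteq> 0"
    unfolding * using assms by (simp add: N_iff)
qed

lemma reflection_base_point:
  assumes "x \<in> N"
  shows "reflection u (x - e i0) (e i0) = x"
proof -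
  have "2 * pinner u (x - e i0) (e i0) = - pinner u (x - e i0) (x - e i0)"
    unfolding pinner_axis_vector(1)[OF assms] by (simp add: pinner_simps pinner_basis)
  then show ?thesis
    using pinner_axis_vector(2)[OF assms] by (simp add: reflection_def)
qed

lemma frame_vector_field:
  assumes "i \<noteq> i0"
  shows "frame i \<in> vector_fields N"
proof -
  let ?D = "\<lambda>x. pinner u x (e i0) - psign u i0"
  have "smooth_on U0 (\<lambda>x. e i + (pinner u (x + - e i0) (e i) * inverse (?D x)) *\<^sub>R (x + - e i0))"
  proof (intro smooth_on_add[OF open_U0] smooth_on_const open_U0
      smooth_on_bilinear[OF bounded_bilinear_scaleR open_U0]
      smooth_on_bilinear[OF bounded_bilinear_mult open_U0]
      smooth_on_bilinear[OF bounded_bilinear_pinner open_U0]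
      smooth_on_bounded_linear[OF bounded_linear_ident open_U0] smooth_on_inverse)
    show "smooth_on U0 ?D"
      using smooth_on_add[OF open_U0
          smooth_on_bounded_linear[OF bounded_linear_pinner_left open_U0] smooth_on_const,
          of u "e i0" "- psign u i0"] by simp
  qed (simp add: U0_def)
  then have "smooth_on_submanifold N
      (\<lambda>x. e i + (pinner u (x + - e i0) (e i) * inverse (?D x)) *\<^sub>R (x + - e i0))"
    by (rule smooth_on_imp_smooth_on_submanifold[OF open_U0, rotated]) (simp add: N_def)
  then have "smooth_on_submanifold N (frame i)"
  proof (rule smooth_on_submanifold_cong)
    fix x assume x: "x \<in> N"
    have "2 * pinner u (x - e i0) (e i) / pinner u (x - e i0) (x - e i0)
      = - (pinner u (x - e i0) (e i) * inverse (?D x))"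
      using pinner_axis_vector(2)[OF x] unfolding pinner_axis_vector(1)[OF x]
      by (simp add: field_simps)
    then show "e i + (pinner u (x + - e i0) (e i) * inverse (?D x)) *\<^sub>R (x + - e i0) = frame i x"
      by (simp add: frame_def reflection_def)
  qed
  moreover have "pinner u (frame i x) x = 0" if "x \<in> N" for x
  proof -
    have "pinner u (frame i x) x = pinner u (frame i x) (reflection u (x - e i0) (e i0))"
      using reflection_base_point[OF that] by simp
    also have "\<dots> = 0"
      using reflection_isometry[OF pinner_axis_vector(2)[OF that]] assms
      by (simp add: frame_def pinner_basis)
    finally show ?thesis .
  qed
  ultimately show ?thesis by (simp add: vector_fields_N)
qed

lemma span_frame:
  assumes x: "x \<in> N"
  shows "span ((\<lambda>i. frame i x) ` (UNIV - {i0})) = {w. pinner u w x = 0}"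
proof (intro equalityI)
  let ?R = "reflection u (x - e i0)"
  show "span ((\<lambda>i. frame i x) ` (UNIV - {i0})) \<subseteq> {w. pinner u w x = 0}"
  proof (rule span_minimal)
    show "(\<lambda>i. frame i x) ` (UNIV - {i0}) \<subseteq> {w. pinner u w x = 0}"
      using vector_field_orthogonal(1)[OF frame_vector_field x] by auto
    show "subspace {w. pinner u w x = 0}"
      by (rule subspaceI) (simp_all add: pinner_simps)
  qed
  show "{w. pinner u w x = 0} \<subseteq> span ((\<lambda>i. frame i x) ` (UNIV - {i0}))"
  proof (intro subsetI, drule CollectD)
    fix w assume w: "pinner u w x = 0"
    have "pinner u (?R w) (e i0) = 0"
      using w by (simp add: reflection_self_adjoint reflection_base_point[OF x])
    then have 0: "?R w $ i0 = 0"
      by (simp add: pinner_axis psign_def split: if_splits)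
    have "?R w = (\<Sum>i\<in>UNIV. (?R w $ i) *\<^sub>R e i)"
      by (simp add: vec_eq_iff axis_def sum_component if_distrib[of "\<lambda>c. _ * c"] cong: if_cong)
    also have "\<dots> = (\<Sum>i\<in>UNIV - {i0}. (?R w $ i) *\<^sub>R e i)"
      by (rule sum.mono_neutral_right) (simp_all add: 0)
    finally have "?R (?R w) = ?R (\<Sum>i\<in>UNIV - {i0}. (?R w $ i) *\<^sub>R e i)" by simp
    then have "w = (\<Sum>i\<in>UNIV - {i0}. (?R w $ i) *\<^sub>R frame i x)"
      by (simp add: reflection_involutive[OF pinner_axis_vector(2)[OF x]] frame_def
          linear_sum[OF linear_reflection] linear_cmul[OF linear_reflection])
    moreover have "\<dots> \<in> span ((\<lambda>i. frame i x) ` (UNIV - {i0}))"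
      by (intro span_sum span_scale span_base imageI)
    ultimately show "w \<in> span ((\<lambda>i. frame i x) ` (UNIV - {i0}))" by simp
  qed
qed

lemma orthonormal_frame_exists:
  obtains d E \<epsilon> where "orthonormal_frame u N d E \<epsilon>"
proof -
  define d where "d = card (UNIV - {i0})"
  obtain h where h: "bij_betw h {0..<d} (UNIV - {i0})"
    unfolding d_def using ex_bij_betw_nat_finite[OF finite[of "UNIV - {i0}"]] by (rule exE)
  have inj: "h i = h j \<longleftrightarrow> i = j" if "i < d" "j < d" for i j
    by (rule inj_on_eq_iff[OF bij_betw_imp_inj_on[OF h]]) (use that in simp_all)
  have img: "h ` {..<d} = UNIV - {i0}"
    using bij_betw_imp_surj_on[OF h] by (simp add: lessThan_atLeast0)
  have ne: "h i \<noteq> i0" if "i < d" for i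
    using img imageI[of i "{..<d}" h] that by simp
  have "orthonormal_frame u N d (\<lambda>i. frame (h i)) (\<lambda>i. psign u (h i))"
    unfolding orthonormal_frame_def
  proof (intro conjI allI impI ballI)
    show "psign u (h i) = 1 \<or> psign u (h i) = - 1" for i
      by (simp add: psign_def)
    show "frame (h i) \<in> vector_fields N" if "i < d" for i
      by (rule frame_vector_field[OF ne[OF that]])
    fix x assume x: "x \<in> N"
    show "pinner u (frame (h i) x) (frame (h j) x) = (if i = j then psign u (h i) else 0)"
      if "i < d" "j < d" for i j
      using reflection_isometry[OF pinner_axis_vector(2)[OF x]] inj[OF that]
      by (simp add: frame_def pinner_basis)
    have "(\<lambda>i. frame (h i) x) ` {..<d} = (\<lambda>i. frame i x) ` (UNIV - {i0})"
      unfolding img[symmetric] by (simp add: image_image)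
    then show "span ((\<lambda>i. frame (h i) x) ` {..<d}) = tangent_space N x"
      by (simp add: span_frame[OF x] tangent_space_N[OF x])
  qed
  then show thesis by (rule that)
qed

end

section \<open>The values of a linear function on a hyperquadric\<close>

context hyperquadric_patch
begin

text \<open>The points where the projection of \<open>a\<close> does not vanish form an open piece. If \<open>\<langle>a, _\<rangle>\<close> took only
  finitely many values there, it would by continuity be constant near \<open>x\<close> along every curve in this
  piece that is differentiable at \<open>x\<close>. But its derivative along a tangent vector \<open>w\<close> is
  \<open>\<langle>tangent_part a x, w\<rangle>\<close>, which is nonzero for some \<open>w\<close> since the tangent space is nondegenerate.\<close>

lemma infinitely_many_values:
  assumes x: "x \<in> N" and "tangent_part a x \<noteq> 0"
  shows "infinite (pinner u a ` (N \<inter> {y. tangent_part a y \<noteq> 0}))"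
proof
  assume fin: "finite (pinner u a ` (N \<inter> {y. tangent_part a y \<noteq> 0}))"
  let ?V = "U \<inter> {y. tangent_part a y \<noteq> 0}"
  have "continuous_on UNIV (tangent_part a)"
    unfolding tangent_part_def[abs_def]
    by (intro continuous_intros bounded_bilinear.continuous_on[OF bounded_bilinear_pinner])
  then have V: "open ?V"
    by (intro open_Int open_U open_Collect_neq continuous_on_const)
  interpret V: hyperquadric_patch u \<kappa> ?V
    by unfold_locales (use kappa V in auto)
  have VN: "V.N = N \<inter> {y. tangent_part a y \<noteq> 0}"
    by (auto simp: V.N_def N_def)
  obtain w where w: "pinner u w x = 0" "pinner u (tangent_part a x) w \<noteq> 0"
    using tangent_nondegenerate[OF x vector_field_orthogonal(1)[OF tangent_part_vector_field x]]
      assms(2) by blast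
  then have l: "pinner u a w \<noteq> 0" by (simp add: pinner_tangent_part)
  have "w \<in> tangent_space V.N x"
    using V.tangent_space_N[of x] x assms(2) w(1) by (simp add: VN)
  then obtain \<gamma> :: "real \<Rightarrow> 'm rvec" where
    \<gamma>: "\<And>t. \<gamma> t \<in> V.N" "\<gamma> 0 = x" "(\<gamma> has_vector_derivative w) (at 0)"
    unfolding tangent_space_def by blast
  define g where "g t = pinner u a (\<gamma> t)" for t
  have "(\<gamma> has_derivative (\<lambda>h. h *\<^sub>R w)) (at 0)"
    using \<gamma>(3) by (simp add: has_vector_derivative_def)
  then have g: "(g has_derivative (\<lambda>h. pinner u a (h *\<^sub>R w))) (at 0)"
    unfolding g_def by (rule has_derivative_compose[OF _ has_derivative_pinner_right])
  have "range g \<subseteq> pinner u a ` (N \<inter> {y. tangent_part a y \<noteq> 0})"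
    using \<gamma>(1) by (auto simp: g_def VN)
  then have "finite (range g - {g 0})"
    using fin finite_subset by blast
  then have "open (- (range g - {g 0}))"
    by (intro open_Compl finite_imp_closed)
  moreover have "(g \<longlongrightarrow> g 0) (at 0)"
    using has_derivative_continuous[OF g] by (simp add: continuous_within)
  ultimately have "\<forall>\<^sub>F t in at 0. g t \<in> - (range g - {g 0})"
    using topological_tendstoD[of g "g 0" "at 0" "- (range g - {g 0})"] by simp
  then have "\<forall>\<^sub>F t in at 0. g t = g 0"
    by (rule eventually_mono) simp
  then have "((\<lambda>t. g 0) has_derivative (\<lambda>h. pinner u a (h *\<^sub>R w))) (at 0)"
    by (rule has_derivative_transform_eventually[OF g]) simp_all
  from has_derivative_unique[OF this has_derivative_const]
  have "(\<lambda>h. pinner u a (h *\<^sub>R w)) = (\<lambda>h. 0)" .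
  from fun_cong[OF this, of 1] show False using l by simp
qed

end

text \<open>The projection of \<open>a\<close> vanishes exactly at the points parallel to \<open>a\<close>. If \<open>a\<close> is not parallel to
  the basis vector \<open>e i0\<close>, then \<open>- e i0\<close> is a suitable point; otherwise any point off the line of \<open>a\<close>
  that belongs to the patch will do.\<close>

lemma (in stereographic_patch) tangent_part_nonzero_somewhere:
  assumes "a \<noteq> 0" and "CARD('m) \<ge> 2"
  obtains x where "x \<in> N" "tangent_part a x \<noteq> 0"
proof (cases "\<exists>k. k \<noteq> i0 \<and> a $ k \<noteq> 0")
  case True
  then obtain k where k: "k \<noteq> i0" "a $ k \<noteq> 0" by blast
  have "psign u i0 \<noteq> 0" by (simp add: psign_def)
  then have "- e i0 \<in> N"
    by (simp add: N_iff pinner_simps pinner_basis)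
  moreover have "tangent_part a (- e i0) $ k \<noteq> 0"
    using k by (simp add: tangent_part_def axis_def)
  then have "tangent_part a (- e i0) \<noteq> 0" by (metis zero_index)
  ultimately show thesis by (rule that)
next
  case False
  have "a $ i0 \<noteq> 0"
    using False assms(1) by (auto simp: vec_eq_iff)
  obtain j where j: "j \<noteq> i0"
  proof -
    have "UNIV \<noteq> {i0}"
    proof
      assume "UNIV = {i0}"
      then have "CARD('m) = card {i0}" by simp
      then show False using assms(2) by simp
    qed
    then show thesis using that by blast
  qed
  \<comment> \<open>A rational point of the circle or of the hyperbola in the plane of two basis vectors.\<close>
  define c s :: real where "c = (if psign u j = psign u i0 then 3/5 else 5/3)"
    and "s = (if psign u j = psign u i0 then 4/5 else 4/3)"
  define x where "x = s *\<^sub>R e j - c *\<^sub>R e i0"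
  have cs: "c > 0" "s \<noteq> 0" by (simp_all add: c_def s_def)
  have sg: "psign u i0 \<noteq> 0" by (simp add: psign_def)
  have aj: "a $ j = 0" using False j by blast
  have "pinner u x x = s * s * psign u j + c * c * psign u i0"
    using j by (simp add: x_def pinner_simps pinner_basis)
  also have "\<dots> = psign u i0"
    by (simp add: c_def s_def psign_def)
  finally have "pinner u x x = psign u i0" .
  moreover have "pinner u x (e i0) \<noteq> psign u i0"
    using j cs sg by (simp add: x_def pinner_simps pinner_basis psign_def)
  ultimately have "x \<in> N" by (simp add: N_iff)
  moreover have "tangent_part a x $ j \<noteq> 0"
  proof -
    have "pinner u a x = - c * psign u i0 * a $ i0"
      by (simp add: x_def pinner_simps pinner_axis aj)
    then show ?thesis
      using aj j cs sg \<open>a $ i0 \<noteq> 0\<close> by (simp add: tangent_part_def x_def axis_def)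
  qed
  then have "tangent_part a x \<noteq> 0" by (metis zero_index)
  ultimately show thesis by (rule that)
qed

section \<open>The classification\<close>

lemma even_quartic_zero:
  fixes c0 c1 c2 :: real
  assumes "infinite A" "\<And>y. y \<in> A \<Longrightarrow> c0 + c1 * y\<^sup>2 + c2 * y ^ 4 = 0"
  shows "c0 = 0 \<and> c1 = 0 \<and> c2 = 0"
proof -
  let ?P = "[:c0, 0, c1, 0, c2:]"
  have "A \<subseteq> {y. poly ?P y = 0}"
    using assms(2) by (auto simp: power2_eq_square power4_eq_xxxx algebra_simps)
  then have "?P = 0"
    using assms(1) poly_roots_finite[of ?P] finite_subset by blast
  then show ?thesis by simp
qed

text \<open>The last equation leaves \<open>q = 0\<close> or \<open>p = n + 1\<close>, the first one \<open>\<mu> = - 1\<close> or \<open>q \<mu> = - 1\<close>. In the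
  case \<open>p = n + 1\<close>, \<open>q \<mu> = - 1\<close> the middle equation factors as \<open>(n + 1) (2 - n - q) = 0\<close>.\<close>

lemma coefficients_vanish_iff:
  fixes n :: nat and \<mu> p q :: real
  assumes "n \<ge> 2"
  shows "(1 + \<mu>) * (1 + q * \<mu>) = 0 \<and>
      p * (2 - real n) - 1 + p * q * \<mu> - q * (1 + \<mu>) * (real n + 1) - q * \<mu> = 0 \<and>
      q * (real n + 1 - p) = 0 \<longleftrightarrow>
    n > 2 \<and> \<mu> = 1 / (real n - 2) \<and> p = real n + 1 \<and> q = 2 - real n \<or>
    \<mu> = - 1 \<and> (p = real n + 1 \<and> q = (1 + real n - (real n)\<^sup>2) / real n \<or>
      n > 2 \<and> p = 1 / (2 - real n) \<and> q = 0)"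
    (is "?A \<and> ?B \<and> ?C \<longleftrightarrow> ?R")
proof
  assume h: "?A \<and> ?B \<and> ?C"
  have n0: "real n \<noteq> 0" using assms by simp
  show ?R
  proof (cases "q = 0")
    case True
    then have "\<mu> = - 1" "p * (2 - real n) = 1" using h by auto
    moreover from this(2) have "real n \<noteq> 2" by auto
    then have "n > 2" using assms by (cases "n = 2") auto
    ultimately show ?thesis using True \<open>real n \<noteq> 2\<close> by (auto simp: field_simps)
  next
    case False
    then have p: "p = real n + 1" using h by auto
    show ?thesis
    proof (cases "\<mu> = - 1")
      case True
      then have "q * real n = 1 + real n - (real n)\<^sup>2"
        using h p by (simp add: algebra_simps power2_eq_square)
      then have "q = (1 + real n - (real n)\<^sup>2) / real n"
        using n0 by (simp add: field_simps)
      then show ?thesis using True p by simp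
    next
      case mu: False
      then have q\<mu>: "q * \<mu> = - 1" using h by auto
      have "(real n + 1) * (2 - real n - q) = 0"
        using h q\<mu> p by algebra
      then have q: "q = 2 - real n" by auto
      then have "real n \<noteq> 2" using False by auto
      then have "n > 2" using assms by (cases "n = 2") auto
      moreover have "\<mu> = 1 / (real n - 2)"
        using q\<mu> q \<open>real n \<noteq> 2\<close> by (simp add: field_simps)
      ultimately show ?thesis using p q by simp
    qed
  qed
next
  assume ?R
  then consider "n > 2" "\<mu> = 1 / (real n - 2)" "p = real n + 1" "q = 2 - real n"
    | "\<mu> = - 1" "p = real n + 1" "q = (1 + real n - (real n)\<^sup>2) / real n"
    | "\<mu> = - 1" "n > 2" "p = 1 / (2 - real n)" "q = 0" by blast
  then show "?A \<and> ?B \<and> ?C"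
  proof cases
    case 1
    have "(2 - real n) * (1 / (real n - 2)) = - 1"
      using 1(1) by (simp add: field_simps)
    then have q\<mu>: "q * \<mu> = - 1" by (simp only: 1(2,4))
    then have "?B" using 1(3,4) by algebra
    then show ?thesis using q\<mu> 1(3) by simp
  next
    case 2
    have "q * real n = 1 + real n - (real n)\<^sup>2" using 2(3) assms by simp
    then have "?B" using 2(1,2) by algebra
    then show ?thesis using 2 by simp
  next
    case 3
    then show ?thesis by (simp add: field_simps)
  qed
qed

text \<open>One frame suffices for the forward direction, since it covers enough points for the linear
  function to take infinitely many values. In the backward direction every frame has \<open>n\<close> members and
  the formula for the tension field applies to all of them.\<close>

theorem pq_harmonic_iff:
  fixes a :: "'m :: {finite,linorder} rvec" and i0 :: 'm and M :: "'m rvec set"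
  assumes card: "CARD('m) = n + 1" "n \<ge> 2" and "a \<noteq> 0"
    and M: "M = {x. pinner u x x = psign u i0}"
  shows "pq_harmonic u M p q (conformal_gradient_field u M a) \<longleftrightarrow>
    (1 + pinner u a a) * (1 + q * pinner u a a) = 0 \<and>
    p * (2 - real n) - 1 + p * q * pinner u a a - q * (1 + pinner u a a) * (real n + 1)
      - q * pinner u a a = 0 \<and>
    q * (real n + 1 - p) = 0"
    (is "_ \<longleftrightarrow> ?A = 0 \<and> ?B = 0 \<and> ?C = 0")
proof -
  define \<sigma> where "\<sigma> = conformal_gradient_field u M a"
  have sg: "psign u i0 = 1 \<or> psign u i0 = - 1" by (simp add: psign_def)
  interpret whole: hyperquadric_patch u "psign u i0" UNIV
    by unfold_locales (simp_all add: sg)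
  have whole: "whole.N = M" by (simp add: whole.N_def M)
  have \<sigma>: "\<sigma> y = hyperquadric_patch.tangent_part u (psign u i0) a y" if "y \<in> M" for y
    using whole.conformal_gradient_field_eq[of y a] that by (simp add: whole \<sigma>_def)
  have tension: "tension u (M \<inter> U) nabla d E \<epsilon> p q \<sigma> x =
      (psign u i0 * ?A + ?B * (pinner u a x)\<^sup>2 + psign u i0 * ?C * pinner u a x ^ 4) *\<^sub>R \<sigma> x"
    if "open U" and LC: "levi_civita u (M \<inter> U) nabla" and E: "orthonormal_frame u (M \<inter> U) d E \<epsilon>"
      and x: "x \<in> M \<inter> U" for U nabla d E \<epsilon> x
  proof -
    interpret P: hyperquadric_patch u "psign u i0" U
      by unfold_locales (simp_all add: sg that(1))
    have PN: "P.N = M \<inter> U" by (simp add: P.N_def M)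
    have d: "real d = real n"
      using P.frame_dimension[unfolded PN, OF E x] card by simp
    have "\<sigma> y = P.tangent_part a y" if "y \<in> M \<inter> U" for y
      using \<sigma> that by simp
    from P.tension_eq[unfolded PN, OF LC E this x] show ?thesis
      unfolding d by simp
  qed
  show ?thesis
    unfolding \<sigma>_def[symmetric]
  proof
    assume harm: "pq_harmonic u M p q \<sigma>"
    interpret S: stereographic_patch u i0 .
    have SN: "S.N = M \<inter> S.U0" by (simp add: S.N_def M)
    obtain d E \<epsilon> where E: "orthonormal_frame u (M \<inter> S.U0) d E \<epsilon>"
      using S.orthonormal_frame_exists[unfolded SN] by blast
    note LC = S.levi_civita_exists[unfolded SN]
    have zero: "tension u (M \<inter> S.U0) S.connection d E \<epsilon> p q \<sigma> x = 0" if "x \<in> M \<inter> S.U0" for x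
      using harm S.open_U0 LC E that unfolding pq_harmonic_def by blast
    obtain x where x: "x \<in> S.N" "S.tangent_part a x \<noteq> 0"
      by (rule S.tangent_part_nonzero_somewhere[OF \<open>a \<noteq> 0\<close>]) (use card in simp_all)
    have "psign u i0 * ?A = 0 \<and> ?B = 0 \<and> psign u i0 * ?C = 0"
    proof (rule even_quartic_zero[OF S.infinitely_many_values[OF x]])
      fix y assume "y \<in> pinner u a ` (S.N \<inter> {z. S.tangent_part a z \<noteq> 0})"
      then obtain z where z: "z \<in> M \<inter> S.U0" "S.tangent_part a z \<noteq> 0" "y = pinner u a z"
        unfolding SN by blast
      then have "\<sigma> z \<noteq> 0" using \<sigma>[of z] by simp
      then show "psign u i0 * ?A + ?B * y\<^sup>2 + psign u i0 * ?C * y ^ 4 = 0"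
        using zero[OF z(1)] tension[OF S.open_U0 LC E z(1)] z(3) by simp
    qed
    then show "?A = 0 \<and> ?B = 0 \<and> ?C = 0" using sg by auto
  next
    assume "?A = 0 \<and> ?B = 0 \<and> ?C = 0"
    then have "psign u i0 * ?A + ?B * (pinner u a x)\<^sup>2 + psign u i0 * ?C * pinner u a x ^ 4 = 0" for x
      by (simp only: mult_zero_left mult_zero_right add_0)
    then show "pq_harmonic u M p q \<sigma>"
      unfolding pq_harmonic_def using tension by (simp only: scaleR_zero_left) blast
  qed
qed

text \<open>On the pseudo-sphere the index is \<open>v < n + 1\<close>, so the first coordinate carries a plus sign. On the
  pseudo-hyperbolic space it is \<open>v + 1 > 0\<close>, so the last coordinate carries a minus sign.\<close>

lemma hyperquadric_has_basis_point:
  fixes M :: "('m :: {finite,linorder}) rvec set"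
  assumes "CARD('m) = n + 1" and "v \<le> n"
    and "(M = pseudo_sphere v \<and> u = v) \<or> (M = pseudo_hyperbolic v \<and> u = v + 1)"
  obtains i0 :: 'm where "M = {x. pinner u x x = psign u i0}"
  using assms(3)
proof
  assume h: "M = pseudo_sphere v \<and> u = v"
  have "{..<Min (UNIV :: 'm set)} = {}"
    by (auto simp: not_less[symmetric])
  then have "psign u (Min (UNIV :: 'm set)) = 1"
    using assms(1,2) h by (simp add: psign_def)
  then show thesis
    using h by (intro that[of "Min UNIV"]) (simp add: pseudo_sphere_def)
next
  assume h: "M = pseudo_hyperbolic v \<and> u = v + 1"
  have "{..<Max (UNIV :: 'm set)} = UNIV - {Max UNIV}"
    by (auto simp: less_le)
  then have "card {..<Max (UNIV :: 'm set)} = n"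
    using assms(1) by simp
  then have "psign u (Max (UNIV :: 'm set)) = - 1"
    using assms(1,2) h by (simp add: psign_def)
  then show thesis
    using h by (intro that[of "Max UNIV"]) (simp add: pseudo_hyperbolic_def)
qed

theorem theorem5p4:
  fixes M :: "('m :: {finite,linorder}) rvec set"
    and a :: "'m rvec"
    and \<sigma> :: "'m rvec \<Rightarrow> 'm rvec"
    and n v u :: nat
    and \<mu> p q :: real
  assumes "CARD('m) = n + 1" and "n \<ge> 2" and "v \<le> n"
    and "(M = pseudo_sphere v \<and> u = v) \<or> (M = pseudo_hyperbolic v \<and> u = v + 1)"
    and "a \<noteq> 0"
    and "\<mu> = pinner u a a"
    and "\<sigma> = conformal_gradient_field u M a"
  shows "(\<mu> \<ge> 0 \<longrightarrow>
            (pq_harmonic u M p q \<sigma> \<longleftrightarrow>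
               n > 2 \<and> \<mu> = 1 / (real n - 2) \<and> p = real n + 1 \<and> q = 2 - real n)) \<and>
         (\<mu> < 0 \<longrightarrow>
            (pq_harmonic u M p q \<sigma> \<longleftrightarrow>
               \<mu> = - 1 \<and>
               ((p = real n + 1 \<and> q = (1 + real n - (real n)\<^sup>2) / real n) \<or>
                (n > 2 \<and> p = 1 / (2 - real n) \<and> q = 0))))"
proof -
  obtain i0 :: 'm where M: "M = {x. pinner u x x = psign u i0}"
    by (rule hyperquadric_has_basis_point[OF assms(1,3,4)])
  have iff: "pq_harmonic u M p q \<sigma> \<longleftrightarrow>
    n > 2 \<and> \<mu> = 1 / (real n - 2) \<and> p = real n + 1 \<and> q = 2 - real n \<or>
    \<mu> = - 1 \<and> (p = real n + 1 \<and> q = (1 + real n - (real n)\<^sup>2) / real n \<or>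
      n > 2 \<and> p = 1 / (2 - real n) \<and> q = 0)"
    using pq_harmonic_iff[OF assms(1,2,5) M] coefficients_vanish_iff[OF assms(2)]
    by (simp only: assms(6,7))
  have pos: "1 / (real n - 2) > 0" if "n > 2" using that by simp
  show ?thesis
  proof (intro conjI impI)
    assume "\<mu> \<ge> 0"
    then have "\<mu> \<noteq> - 1" by simp
    then show "pq_harmonic u M p q \<sigma> \<longleftrightarrow>
      n > 2 \<and> \<mu> = 1 / (real n - 2) \<and> p = real n + 1 \<and> q = 2 - real n"
      unfolding iff by blast
  next
    assume "\<mu> < 0"
    then have "\<not> (n > 2 \<and> \<mu> = 1 / (real n - 2))" using pos by force
    then show "pq_harmonic u M p q \<sigma> \<longleftrightarrow>
      \<mu> = - 1 \<and> (p = real n + 1 \<and> q = (1 + real n - (real n)\<^sup>2) / real n \<or>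
        n > 2 \<and> p = 1 / (2 - real n) \<and> q = 0)"
      unfolding iff by blast
  qed
qed

end
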